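(* The quasifold $M_0^+$ is not a global quotient; that is, there is no quasifold diffeomorphism from $M_0^+$ onto a global quotient $\tilde N/\Delta$.
   Context: **Models.** A (quasifold) model of dimension $k$ is a triple $(\tilde U/\Gamma,p,\tilde U)$ where $\tilde U$ is a connected smooth $k$-manifold, $\Gamma$ is a discrete group acting on $\tilde U$ by diffeomorphisms so that the set of points where the action is not free is closed and has minimal codimension $\ge 2$, $\tilde U/\Gamma$ is the orbit space with the quotient topology, and $p:\tilde U\to\tilde U/\Gamma$ is the projection. A homeomorphism $f:\tilde U/\Gamma\to\tilde V/\Delta$ between models $(\tilde U/\Gamma,p,\tilde U)$, $(\tilde V/\Delta,q,\tilde V)$ is a diffeomorphism of models if there is a diffeomorphism $\tilde f:\tilde U\to\tilde V$ (a lift of $f$) with $q\circ\tilde f=f\circ p$. **Induced models.** If $W\subset\tilde U/\Gamma$ is connected and open, let $\tilde W$ be a connected component of $p^{-1}(W)$ and $\Gamma_{\tilde W}=\{\gamma\in\Gamma\mid\gamma(\tilde W)=\tilde W\}$; then $(\tilde W/\Gamma_{\tilde W},p|_{\tilde W},\tilde W)$, with $\tilde W/\Gamma_{\tilde W}$ identified with $W$, is a model induced by $W\subset\tilde U/\Gamma$. All models induced by $W$ are diffeomorphic. **Universal covering models.** Let $\pi:U^\sharp\to\tilde U$ be the universal covering and $\Gamma^\sharp=\{\gamma^\sharp\in\mathrm{Diff}(U^\sharp)\mid\exists\,\gamma\in\Gamma:\ \pi(\gamma^\sharp(u))=\gamma\pi(u)\ \forall u\in U^\sharp\}$. Then $U^\sharp/\Gamma^\sharp=\tilde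 U/\Gamma$ and $(U^\sharp/\Gamma^\sharp,p\circ\pi,U^\sharp)$ is the universal covering model of $(\tilde U/\Gamma,p,\tilde U)$. "The universal covering model induced by $W\subset \tilde U/\Gamma$" means the universal covering model of a model induced by $W$. **Quasifolds.** A chart of a topological space $M$ is $(U,\tau,\tilde U,p,\Gamma)$ with $U\subset M$ connected open, $(\tilde U/\Gamma,p,\tilde U)$ a model and $\tau:\tilde U/\Gamma\to U$ a homeomorphism. Two charts $\alpha,\beta$ with $U_\alpha\cap U_\beta\neq\emptyset$ are compatible if each $x\in U_\alpha\cap U_\beta$ has a connected open neighbourhood $U^x_{\alpha\beta}\subset U_\alpha\cap U_\beta$ such that $\tau_\beta^{-1}\circ\tau_\alpha:\tau_\alpha^{-1}(U^x_{\alpha\beta})\to\tau_\beta^{-1}(U^x_{\alpha\beta})$ is a diffeomorphism from the universal covering model induced by $\tau_\alpha^{-1}(U^x_{\alpha\beta})\subset\tilde U_\alpha/\Gamma_\alpha$ to the universal covering model induced by $\tau_\beta^{-1}(U^x_{\alpha\beta})\subset\tilde U_\beta/\Gamma_\beta$. An atlas is a collection of compatible charts (of the same dimension) whose domains cover $M$; a quasifold is a topological space with a structure given by an atlas. **Diffeomorphisms of quasifolds.** A diffeomorphism $f$ from a quasifold $M$ (atlas $\mathcal A$) to a quasifold $N$ (atlas $\mathcal B$) is a homeomorphism $f:M\to N$ such that for each $x\in M$ there are a chart $(U_\alpha,\tau_\alpha,\tilde U_\alpha/\Gamma_\alpha)$ containing $x$, a chart $(V_b,k_b,\tilde V_b/\Delta_b)$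 containing $f(x)$, and a connected open set $V$ with $f(x)\in V\subset V_b$, $f^{-1}(V)\subset U_\alpha$, such that $k_b^{-1}\circ f\circ\tau_\alpha:\tau_\alpha^{-1}(f^{-1}(V))\to k_b^{-1}(V)$ is a diffeomorphism from the universal covering model induced by $\tau_\alpha^{-1}(f^{-1}(V))\subset\tilde U_\alpha/\Gamma_\alpha$ to the universal covering model induced by $k_b^{-1}(V)\subset\tilde V_b/\Delta_b$; and the same holds for $f^{-1}$. **Global quotients.** A global quotient is a quasifold of the form $\tilde N/\Delta$, where $\tilde N$ is a connected smooth manifold and $\Delta$ is a discrete group acting on $\tilde N$ by diffeomorphisms so that the set of points where the action is not free is closed and has minimal codimension $\geq 2$; it is covered by one chart, given by the model $\tilde N/\Delta$ itself. **The quasifold $M_0^+$** (associated to the Penrose kite). Let $\phi=\frac{1+\sqrt5}2$, $\sigma=\frac1{2\phi}\sqrt{2+\phi}$. Let $N\subset T^4=\mathbb R^4/\mathbb Z^4$ be the subgroup $N=\{\exp(-s+\phi t,\,s,\,t,\,-t+\phi s)\mid s,t\in\mathbb R\}$, acting on $\mathbb C^4$ by restriction of the standard action $\exp(\theta)\cdot z=(e^{2\pi i\theta_1}z_1,\dots,e^{2\pi i\theta_4}z_4)$. Let $$\Psi(z)=\Big(|z_1|^2+\tfrac1\phi|z_2|^2+|z_3|^2-\phi\sigma,\ -\tfrac1\phi|z_1|^2+\tfrac1\phi|z_2|^2+|z_4|^2-\tfrac\sigma\phi\Big)$$ and $M_0^+=\Psi^{-1}(0)/N$ with the quotient topology. Its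 quasifold structure is given by an atlas of four charts, one for each $(\{i,j\},\{k,l\})$ among $(\{1,2\},\{3,4\})$, $(\{3,4\},\{1,2\})$, $(\{1,4\},\{2,3\})$, $(\{2,3\},\{1,4\})$: $\tilde U_{ij}\subset\mathbb C^2$ is the open set of $(z_i,z_j)$ for which there are (necessarily unique) real $z_k>0$, $z_l>0$ with $(z_1,z_2,z_3,z_4)\in\Psi^{-1}(0)$; $\Gamma_{ij}$ is the group of elements of $N$ whose $k$-th and $l$-th components equal $1$, acting on $\tilde U_{ij}$ through its $i$-th and $j$-th components; $U_{ij}=\{z\in\Psi^{-1}(0)\mid z_k\ne0,\ z_l\neq0\}/N$; and $\tau_{ij}:\tilde U_{ij}/\Gamma_{ij}\to U_{ij}$ sends $[(z_i,z_j)]$ to the class of $(z_1,z_2,z_3,z_4)$. For instance $\tilde U_{12}=\{|z_1|^2+\frac1\phi|z_2|^2<\phi\sigma,\ -|z_1|^2+|z_2|^2<\sigma\}$ and $\Gamma_{12}=\{(e^{-2\pi i h/\phi},e^{2\pi i(h+k)/\phi})\mid h,k\in\mathbb Z\}$. *)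

theory Defs
  imports "HOL-Analysis.Analysis" "HOL-Algebra.Group_Action"
begin

section \<open>Topological preliminaries\<close>

definition quotient_topology :: "'a topology \<Rightarrow> ('a \<Rightarrow> 'b) \<Rightarrow> 'b topology" where
  "quotient_topology X p =
     topology (\<lambda>S. S \<subseteq> p ` topspace X \<and> openin X {x \<in> topspace X. p x \<in> S})"

lemma openin_quotient_topology:
  "openin (quotient_topology X p) S \<longleftrightarrow>
     S \<subseteq> p ` topspace X \<and> openin X {x \<in> topspace X. p x \<in> S}"
proof -
  have "istopology (\<lambda>S. S \<subseteq> p ` topspace X \<and> openin X {x \<in> topspace X. p x \<in> S})"
    unfolding istopology_def
  proof (intro conjI allI impI)
    fix S T
    assume S: "S \<subseteq> p ` topspace X \<and> openin X {x \<in> topspace X. p x \<in> S}"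
      and T: "T \<subseteq> p ` topspace X \<and> openin X {x \<in> topspace X. p x \<in> T}"
    show "S \<inter> T \<subseteq> p ` topspace X" using S by blast
    have "{x \<in> topspace X. p x \<in> S \<inter> T} =
          {x \<in> topspace X. p x \<in> S} \<inter> {x \<in> topspace X. p x \<in> T}" by blast
    then show "openin X {x \<in> topspace X. p x \<in> S \<inter> T}"
      using S T by (simp add: openin_Int)
  next
    fix K
    assume K: "\<forall>S\<in>K. S \<subseteq> p ` topspace X \<and> openin X {x \<in> topspace X. p x \<in> S}"
    show "\<Union>K \<subseteq> p ` topspace X" using K by blast
    have "{x \<in> topspace X. p x \<in> \<Union>K} = (\<Union>S\<in>K. {x \<in> topspace X. p x \<in> S})" by blast
    then show "openin X {x \<in> topspace X. p x \<in> \<Union>K}"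
      using K by auto
  qed
  then show ?thesis
    by (simp add: quotient_topology_def topology_inverse')
qed

text \<open>
  The library's \<open>simply_connected\<close>, transcribed to abstract topologies; as there, path
  connectedness is included (take two constant loops).
\<close>

definition simply_connected_space :: "'a topology \<Rightarrow> bool" where
  "simply_connected_space X \<longleftrightarrow>
     (\<forall>p q. pathin X p \<and> p 1 = p 0 \<and> pathin X q \<and> q 1 = q 0 \<longrightarrow>
        homotopic_with (\<lambda>r. r 1 = r 0) (top_of_set {0..1}) X p q)"


section \<open>Smooth manifolds\<close>

text \<open>
  A manifold of dimension \<open>k\<close> is modelled on a real normed space of dimension \<open>k\<close>. The class
  \<open>euclidean_space\<close> is not used because it excludes \<open>k = 0\<close>.
\<close>

fun C_on :: "nat \<Rightarrow> 'e::real_normed_vector set \<Rightarrow> ('e \<Rightarrow> 'f::real_normed_vector) \<Rightarrow> bool" where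
  "C_on 0 S f \<longleftrightarrow> continuous_on S f"
| "C_on (Suc n) S f \<longleftrightarrow>
     (\<forall>x\<in>S. f differentiable (at x)) \<and> (\<forall>v. C_on n S (\<lambda>x. frechet_derivative f (at x) v))"

text \<open>Only used for open \<open>S\<close> in finite-dimensional spaces.\<close>

definition smooth_on :: "'e::real_normed_vector set \<Rightarrow> ('e \<Rightarrow> 'f::real_normed_vector) \<Rightarrow> bool" where
  "smooth_on S f \<longleftrightarrow> (\<forall>n. C_on n S f)"

type_synonym ('a, 'e) coords = "'a set \<times> ('a \<Rightarrow> 'e)"

record ('a, 'e) mfd =
  mtop :: "'a topology"
  matlas :: "('a, 'e) coords set"

abbreviation pts :: "('a, 'e) mfd \<Rightarrow> 'a set" where
  "pts M \<equiv> topspace (mtop M)"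

definition coordinates :: "'a topology \<Rightarrow> ('a, 'e::real_normed_vector) coords \<Rightarrow> bool" where
  "coordinates X = (\<lambda>(U, \<phi>).
     openin X U \<and> open (\<phi> ` U) \<and>
     homeomorphic_map (subtopology X U) (top_of_set (\<phi> ` U)) \<phi>)"

definition smooth_change ::
    "('a, 'e::real_normed_vector) coords \<Rightarrow> ('a, 'e) coords \<Rightarrow> bool" where
  "smooth_change = (\<lambda>(U, \<phi>) (V, \<psi>). smooth_on (\<phi> ` (U \<inter> V)) (\<psi> \<circ> inv_into U \<phi>))"

definition smooth_manifold :: "('a, 'e::real_normed_vector) mfd \<Rightarrow> bool" where
  "smooth_manifold M \<longleftrightarrow>
     (\<exists>B::'e set. finite B \<and> span B = UNIV) \<and>
     Hausdorff_space (mtop M) \<and> second_countable (mtop M) \<and>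
     (\<forall>c\<in>matlas M. coordinates (mtop M) c) \<and>
     (\<forall>c\<in>matlas M. \<forall>d\<in>matlas M. smooth_change c d) \<and>
     (\<Union>c\<in>matlas M. fst c) = pts M"

definition mfd_dim :: "('a, 'e::real_normed_vector) mfd \<Rightarrow> nat" where
  "mfd_dim M = dim (UNIV :: 'e set)"

definition maximal_atlas :: "('a, 'e::real_normed_vector) mfd \<Rightarrow> ('a, 'e) coords set" where
  "maximal_atlas M =
     {c. coordinates (mtop M) c \<and> (\<forall>d\<in>matlas M. smooth_change c d \<and> smooth_change d c)}"

definition smooth_map ::
    "('a, 'e::real_normed_vector) mfd \<Rightarrow> ('b, 'f::real_normed_vector) mfd \<Rightarrow> ('a \<Rightarrow> 'b) \<Rightarrow> bool" where
  "smooth_map M N f \<longleftrightarrow>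
     continuous_map (mtop M) (mtop N) f \<and>
     (\<forall>(U, \<phi>)\<in>matlas M. \<forall>(V, \<psi>)\<in>matlas N.
        smooth_on (\<phi> ` {x\<in>U. f x \<in> V}) (\<psi> \<circ> f \<circ> inv_into U \<phi>))"

definition diffeo ::
    "('a, 'e::real_normed_vector) mfd \<Rightarrow> ('b, 'f::real_normed_vector) mfd \<Rightarrow> ('a \<Rightarrow> 'b) \<Rightarrow> bool" where
  "diffeo M N f \<longleftrightarrow>
     homeomorphic_map (mtop M) (mtop N) f \<and>
     smooth_map M N f \<and> smooth_map N M (inv_into (pts M) f)"

definition open_sub :: "('a, 'e) mfd \<Rightarrow> 'a set \<Rightarrow> ('a, 'e) mfd" where
  "open_sub M W =
     \<lparr>mtop = subtopology (mtop M) W, matlas = (\<lambda>(U, \<phi>). (U \<inter> W, \<phi>)) ` matlas M\<rparr>"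

text \<open>Embedded submanifolds, through slice charts.\<close>

definition submanifold :: "('a, 'e::real_normed_vector) mfd \<Rightarrow> nat \<Rightarrow> 'a set \<Rightarrow> bool" where
  "submanifold M d S \<longleftrightarrow>
     S \<subseteq> pts M \<and>
     (\<forall>x\<in>S. \<exists>(U, \<phi>)\<in>maximal_atlas M. \<exists>L. x \<in> U \<and> subspace L \<and> dim L = d \<and>
        \<phi> ` (U \<inter> S) = \<phi> ` U \<inter> L)"

text \<open>
  The singular set of an action need not be a submanifold, and may have pieces of different
  dimensions. It has minimal codimension at least \<open>c\<close> if it is covered by countably many
  submanifolds, each of codimension at least \<open>c\<close>.
\<close>

definition codim_at_least :: "('a, 'e::real_normed_vector) mfd \<Rightarrow> nat \<Rightarrow> 'a set \<Rightarrow> bool" where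
  "codim_at_least M c S \<longleftrightarrow>
     (\<exists>\<S>. countable \<S> \<and> S \<subseteq> \<Union>\<S> \<and>
        (\<forall>T\<in>\<S>. \<exists>d. submanifold M d T \<and> d + c \<le> mfd_dim M))"

text \<open>
  Universal coverings; each sheet over an evenly covered open set is mapped diffeomorphically.
\<close>

definition universal_covering ::
    "('c, 'e::real_normed_vector) mfd \<Rightarrow> ('c \<Rightarrow> 'a) \<Rightarrow> ('a, 'e) mfd \<Rightarrow> bool" where
  "universal_covering C \<pi> M \<longleftrightarrow>
     smooth_manifold C \<and> simply_connected_space (mtop C) \<and>
     continuous_map (mtop C) (mtop M) \<pi> \<and> \<pi> ` pts C = pts M \<and>
     (\<forall>x\<in>pts M. \<exists>T. x \<in> T \<and> openin (mtop M) T \<and>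
        (\<exists>\<V>. \<Union>\<V> = {u\<in>pts C. \<pi> u \<in> T} \<and> (\<forall>V\<in>\<V>. openin (mtop C) V) \<and>
             pairwise disjnt \<V> \<and> (\<forall>V\<in>\<V>. diffeo (open_sub C V) (open_sub M T) \<pi>)))"


section \<open>Models\<close>

text \<open>
  The orbit space is a component \<open>base\<close> of a model, together with the projection, and is only
  required to be an orbit space in \<open>is_model\<close>. This accommodates the identifications of the
  orbit space of an induced model with the open set \<open>W\<close>, and of the orbit space of the universal
  covering model with the original one. The group carries no topology, i.e. it is discrete.
\<close>

record ('a, 'e, 'g, 'x) model =
  cover :: "('a, 'e) mfd"
  grp :: "'g monoid"
  act :: "'g \<Rightarrow> 'a \<Rightarrow> 'a"
  base :: "'x topology"
  proj :: "'a \<Rightarrow> 'x"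

definition nonfree_points :: "('a, 'e, 'g, 'x) model \<Rightarrow> 'a set" where
  "nonfree_points m = {x \<in> pts (cover m). stabilizer (grp m) (act m) x \<noteq> {\<one>\<^bsub>grp m\<^esub>}}"

definition is_model :: "('a, 'e::real_normed_vector, 'g, 'x) model \<Rightarrow> bool" where
  "is_model m \<longleftrightarrow>
     smooth_manifold (cover m) \<and> connected_space (mtop (cover m)) \<and>
     group_action (grp m) (pts (cover m)) (act m) \<and>
     (\<forall>g\<in>carrier (grp m). diffeo (cover m) (cover m) (act m g)) \<and>
     closedin (mtop (cover m)) (nonfree_points m) \<and>
     codim_at_least (cover m) 2 (nonfree_points m) \<and>
     quotient_map (mtop (cover m)) (base m) (proj m) \<and>
     (\<forall>x\<in>pts (cover m). \<forall>y\<in>pts (cover m).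
        proj m x = proj m y \<longleftrightarrow> y \<in> orbit (grp m) (act m) x)"

definition quotient_model ::
    "('a, 'e) mfd \<Rightarrow> 'g monoid \<Rightarrow> ('g \<Rightarrow> 'a \<Rightarrow> 'a) \<Rightarrow> ('a, 'e, 'g, 'a set) model" where
  "quotient_model M G \<theta> =
     \<lparr>cover = M, grp = G, act = \<theta>,
      base = quotient_topology (mtop M) (orbit G \<theta>), proj = orbit G \<theta>\<rparr>"

definition model_diffeo ::
    "('a, 'e::real_normed_vector, 'g, 'x) model \<Rightarrow> ('b, 'f::real_normed_vector, 'h, 'y) model \<Rightarrow>
     ('x \<Rightarrow> 'y) \<Rightarrow> bool" where
  "model_diffeo m n f \<longleftrightarrow>
     homeomorphic_map (base m) (base n) f \<and>
     (\<exists>F. diffeo (cover m) (cover n) F \<and> (\<forall>u\<in>pts (cover m). proj n (F u) = f (proj m u)))"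

definition restricted_model ::
    "('a, 'e, 'g, 'x) model \<Rightarrow> 'x set \<Rightarrow> 'a set \<Rightarrow> ('a, 'e, 'g, 'x) model" where
  "restricted_model m W C =
     \<lparr>cover = open_sub (cover m) C,
      grp = (grp m)\<lparr>carrier := {g \<in> carrier (grp m). act m g ` C = C}\<rparr>,
      act = (\<lambda>g. restrict (act m g) C),
      base = subtopology (base m) W, proj = restrict (proj m) C\<rparr>"

definition induced_models ::
    "('a, 'e, 'g, 'x) model \<Rightarrow> 'x set \<Rightarrow> ('a, 'e, 'g, 'x) model set" where
  "induced_models m W =
     restricted_model m W `
       connected_components_of (subtopology (mtop (cover m)) {x \<in> pts (cover m). proj m x \<in> W})"

definition lifted_diffeos ::
    "('c, 'e::real_normed_vector) mfd \<Rightarrow> ('c \<Rightarrow> 'a) \<Rightarrow> ('a, 'e, 'g, 'x) model \<Rightarrow> ('c \<Rightarrow> 'c) set" where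
  "lifted_diffeos C \<pi> m =
     {f \<in> Bij (pts C). diffeo C C f \<and>
        (\<exists>g\<in>carrier (grp m). \<forall>u\<in>pts C. \<pi> (f u) = act m g (\<pi> u))}"

definition covering_model ::
    "('c, 'e::real_normed_vector) mfd \<Rightarrow> ('c \<Rightarrow> 'a) \<Rightarrow> ('a, 'e, 'g, 'x) model \<Rightarrow>
     ('c, 'e, 'c \<Rightarrow> 'c, 'x) model" where
  "covering_model C \<pi> m =
     \<lparr>cover = C, grp = (BijGroup (pts C))\<lparr>carrier := lifted_diffeos C \<pi> m\<rparr>, act = (\<lambda>f. f),
      base = base m, proj = proj m \<circ> \<pi>\<rparr>"

text \<open>
  The points of the standard universal covering of a manifold on \<open>'a\<close> are homotopy classes of
  paths, i.e. elements of type \<open>(real \<Rightarrow> 'a) set\<close>; so that type carries a copy of every universal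
  covering.
\<close>

definition universal_covering_models ::
    "('a, 'e::real_normed_vector, 'g, 'x) model \<Rightarrow>
     ((real \<Rightarrow> 'a) set, 'e, (real \<Rightarrow> 'a) set \<Rightarrow> (real \<Rightarrow> 'a) set, 'x) model set" where
  "universal_covering_models m = {covering_model C \<pi> m | C \<pi>. universal_covering C \<pi> (cover m)}"

text \<open>
  A diffeomorphism from the universal covering model induced by \<open>W\<close> to the one induced by \<open>W'\<close>.
  As different choices of the component and of the universal covering give models that are
  diffeomorphic over the identity of \<open>W\<close>, it does not matter which ones are used.
\<close>

definition induced_cover_diffeo ::
    "('a, 'e::real_normed_vector, 'g, 'x) model \<Rightarrow> 'x set \<Rightarrow>
     ('b, 'f::real_normed_vector, 'h, 'y) model \<Rightarrow> 'y set \<Rightarrow> ('x \<Rightarrow> 'y) \<Rightarrow> bool" where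
  "induced_cover_diffeo m W n W' f \<longleftrightarrow>
     (\<exists>m'\<in>induced_models m W. \<exists>n'\<in>induced_models n W'.
      \<exists>m''\<in>universal_covering_models m'. \<exists>n''\<in>universal_covering_models n'.
        model_diffeo m'' n'' f)"


section \<open>Quasifolds\<close>

text \<open>
  The records carry only the data of a chart and of an atlas; the conditions are \<open>is_qchart\<close> and
  \<open>is_quasifold\<close>. Diffeomorphisms are defined from the data alone, as for manifolds above.
\<close>

record ('m, 'a, 'e, 'g, 'x) qchart =
  domain :: "'m set"
  param :: "'x \<Rightarrow> 'm"
  qmodel :: "('a, 'e, 'g, 'x) model"

record ('m, 'a, 'e, 'g, 'x) quasifold =
  qtop :: "'m topology"
  qatlas :: "('m, 'a, 'e, 'g, 'x) qchart set"

abbreviation model_pts :: "('m, 'a, 'e, 'g, 'x) qchart \<Rightarrow> 'x set" where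
  "model_pts \<alpha> \<equiv> topspace (base (qmodel \<alpha>))"

definition param_inv :: "('m, 'a, 'e, 'g, 'x) qchart \<Rightarrow> 'm \<Rightarrow> 'x" where
  "param_inv \<alpha> = inv_into (model_pts \<alpha>) (param \<alpha>)"

definition param_preimage :: "('m, 'a, 'e, 'g, 'x) qchart \<Rightarrow> 'm set \<Rightarrow> 'x set" where
  "param_preimage \<alpha> V = {x \<in> model_pts \<alpha>. param \<alpha> x \<in> V}"

definition is_qchart :: "'m topology \<Rightarrow> ('m, 'a, 'e::real_normed_vector, 'g, 'x) qchart \<Rightarrow> bool" where
  "is_qchart X \<alpha> \<longleftrightarrow>
     openin X (domain \<alpha>) \<and> connectedin X (domain \<alpha>) \<and> is_model (qmodel \<alpha>) \<and>
     homeomorphic_map (base (qmodel \<alpha>)) (subtopology X (domain \<alpha>)) (param \<alpha>)"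

definition compatible ::
    "'m topology \<Rightarrow> ('m, 'a, 'e::real_normed_vector, 'g, 'x) qchart \<Rightarrow>
     ('m, 'a, 'e, 'g, 'x) qchart \<Rightarrow> bool" where
  "compatible X \<alpha> \<beta> \<longleftrightarrow>
     (\<forall>x \<in> domain \<alpha> \<inter> domain \<beta>. \<exists>U. x \<in> U \<and> U \<subseteq> domain \<alpha> \<inter> domain \<beta> \<and>
        openin X U \<and> connectedin X U \<and>
        induced_cover_diffeo (qmodel \<alpha>) (param_preimage \<alpha> U) (qmodel \<beta>) (param_preimage \<beta> U)
          (param_inv \<beta> \<circ> param \<alpha>))"

definition is_quasifold :: "('m, 'a, 'e::real_normed_vector, 'g, 'x) quasifold \<Rightarrow> bool" where
  "is_quasifold Q \<longleftrightarrow>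
     (\<forall>\<alpha>\<in>qatlas Q. is_qchart (qtop Q) \<alpha>) \<and>
     (\<forall>\<alpha>\<in>qatlas Q. \<forall>\<beta>\<in>qatlas Q. compatible (qtop Q) \<alpha> \<beta>) \<and>
     (\<Union>\<alpha>\<in>qatlas Q. domain \<alpha>) = topspace (qtop Q)"

definition locally_model_diffeo ::
    "('m, 'a, 'e::real_normed_vector, 'g, 'x) quasifold \<Rightarrow>
     ('n, 'b, 'f::real_normed_vector, 'h, 'y) quasifold \<Rightarrow> ('m \<Rightarrow> 'n) \<Rightarrow> bool" where
  "locally_model_diffeo P Q f \<longleftrightarrow>
     (\<forall>x\<in>topspace (qtop P). \<exists>\<alpha>\<in>qatlas P. \<exists>\<beta>\<in>qatlas Q. \<exists>V.
        x \<in> domain \<alpha> \<and> f x \<in> V \<and> V \<subseteq> domain \<beta> \<and>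
        openin (qtop Q) V \<and> connectedin (qtop Q) V \<and>
        {y \<in> topspace (qtop P). f y \<in> V} \<subseteq> domain \<alpha> \<and>
        induced_cover_diffeo
          (qmodel \<alpha>) (param_preimage \<alpha> {y \<in> topspace (qtop P). f y \<in> V})
          (qmodel \<beta>) (param_preimage \<beta> V)
          (param_inv \<beta> \<circ> f \<circ> param \<alpha>))"

definition quasifold_diffeo ::
    "('m, 'a, 'e::real_normed_vector, 'g, 'x) quasifold \<Rightarrow>
     ('n, 'b, 'f::real_normed_vector, 'h, 'y) quasifold \<Rightarrow> ('m \<Rightarrow> 'n) \<Rightarrow> bool" where
  "quasifold_diffeo P Q f \<longleftrightarrow>
     homeomorphic_map (qtop P) (qtop Q) f \<and> locally_model_diffeo P Q f \<and>
     locally_model_diffeo Q P (inv_into (topspace (qtop P)) f)"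

definition global_quotient ::
    "('a, 'e) mfd \<Rightarrow> 'g monoid \<Rightarrow> ('g \<Rightarrow> 'a \<Rightarrow> 'a) \<Rightarrow> ('a set, 'a, 'e, 'g, 'a set) quasifold" where
  "global_quotient M G \<theta> =
     \<lparr>qtop = base (quotient_model M G \<theta>),
      qatlas = {\<lparr>domain = topspace (base (quotient_model M G \<theta>)), param = (\<lambda>x. x),
                 qmodel = quotient_model M G \<theta>\<rparr>}\<rparr>"


section \<open>The quasifold associated to the Penrose kite\<close>

definition golden :: real where
  "golden = (1 + sqrt 5) / 2"

definition kite_sigma :: real where
  "kite_sigma = 1 / (2 * golden) * sqrt (2 + golden)"

text \<open>\<open>T\<^sup>4\<close> is viewed inside \<open>\<complex>\<^sup>4\<close>, through \<open>exp(\<theta>) = (e\<^bsup>2\<pi>i\<theta>\<^sub>1\<^esup>, \<dots>, e\<^bsup>2\<pi>i\<theta>\<^sub>4\<^esup>)\<close>.\<close>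

definition torus_exp :: "real ^ 4 \<Rightarrow> complex ^ 4" where
  "torus_exp \<theta> = (\<chi> j. cis (2 * pi * \<theta> $ j))"

definition torus_act :: "complex ^ 4 \<Rightarrow> complex ^ 4 \<Rightarrow> complex ^ 4" where
  "torus_act u z = (\<chi> j. u $ j * z $ j)"

definition torus_group :: "(complex ^ 4) monoid" where
  "torus_group = \<lparr>carrier = range torus_exp, mult = torus_act, one = (\<chi> j. 1)\<rparr>"

definition kite_N :: "(complex ^ 4) set" where
  "kite_N = {torus_exp (vector [- s + golden * t, s, t, - t + golden * s]) | s t. True}"

definition kite_group :: "(complex ^ 4) monoid" where
  "kite_group = torus_group\<lparr>carrier := kite_N\<rparr>"

definition kite_Psi :: "complex ^ 4 \<Rightarrow> real \<times> real" where
  "kite_Psi z =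
     ((cmod (z $ 1))\<^sup>2 + 1 / golden * (cmod (z $ 2))\<^sup>2 + (cmod (z $ 3))\<^sup>2 - golden * kite_sigma,
      - (1 / golden) * (cmod (z $ 1))\<^sup>2 + 1 / golden * (cmod (z $ 2))\<^sup>2 + (cmod (z $ 4))\<^sup>2
        - kite_sigma / golden)"

definition kite_level :: "(complex ^ 4) set" where
  "kite_level = {z. kite_Psi z = (0, 0)}"

abbreviation kite_class :: "complex ^ 4 \<Rightarrow> (complex ^ 4) set" where
  "kite_class \<equiv> orbit kite_group torus_act"

text \<open>
  Below, \<open>{i, j}\<close> and \<open>{k, l}\<close> are complementary in \<open>{1, 2, 3, 4}\<close>.
\<close>

definition kite_lift_of :: "4 \<Rightarrow> 4 \<Rightarrow> 4 \<Rightarrow> 4 \<Rightarrow> complex \<times> complex \<Rightarrow> complex ^ 4 \<Rightarrow> bool" where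
  "kite_lift_of i j k l w z \<longleftrightarrow>
     z \<in> kite_level \<and> z $ i = fst w \<and> z $ j = snd w \<and>
     (\<exists>r>0. z $ k = of_real r) \<and> (\<exists>r>0. z $ l = of_real r)"

definition kite_U :: "4 \<Rightarrow> 4 \<Rightarrow> 4 \<Rightarrow> 4 \<Rightarrow> (complex \<times> complex) set" where
  "kite_U i j k l = {w. \<exists>z. kite_lift_of i j k l w z}"

definition kite_lift :: "4 \<Rightarrow> 4 \<Rightarrow> 4 \<Rightarrow> 4 \<Rightarrow> complex \<times> complex \<Rightarrow> complex ^ 4" where
  "kite_lift i j k l w = (THE z. kite_lift_of i j k l w z)"

definition kite_U_mfd ::
    "4 \<Rightarrow> 4 \<Rightarrow> 4 \<Rightarrow> 4 \<Rightarrow> (complex \<times> complex, complex \<times> complex) mfd" where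
  "kite_U_mfd i j k l =
     \<lparr>mtop = top_of_set (kite_U i j k l), matlas = {(kite_U i j k l, \<lambda>w. w)}\<rparr>"

definition kite_Gamma :: "4 \<Rightarrow> 4 \<Rightarrow> (complex ^ 4) monoid" where
  "kite_Gamma k l = torus_group\<lparr>carrier := {u \<in> kite_N. u $ k = 1 \<and> u $ l = 1}\<rparr>"

definition kite_Gamma_act ::
    "4 \<Rightarrow> 4 \<Rightarrow> 4 \<Rightarrow> 4 \<Rightarrow> complex ^ 4 \<Rightarrow> complex \<times> complex \<Rightarrow> complex \<times> complex" where
  "kite_Gamma_act i j k l u = (\<lambda>w\<in>kite_U i j k l. (u $ i * fst w, u $ j * snd w))"

definition kite_chart ::
    "4 \<Rightarrow> 4 \<Rightarrow> 4 \<Rightarrow> 4 \<Rightarrow>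
     ((complex ^ 4) set, complex \<times> complex, complex \<times> complex, complex ^ 4,
      (complex \<times> complex) set) qchart" where
  "kite_chart i j k l =
     \<lparr>domain = kite_class ` {z \<in> kite_level. z $ k \<noteq> 0 \<and> z $ l \<noteq> 0},
      param = (\<lambda>O'. the_elem ((\<lambda>w. kite_class (kite_lift i j k l w)) ` O')),
      qmodel = quotient_model (kite_U_mfd i j k l) (kite_Gamma k l) (kite_Gamma_act i j k l)\<rparr>"

definition kite_quasifold ::
    "((complex ^ 4) set, complex \<times> complex, complex \<times> complex, complex ^ 4,
      (complex \<times> complex) set) quasifold" where
  "kite_quasifold =
     \<lparr>qtop = quotient_topology (top_of_set kite_level) kite_class,
      qatlas = {kite_chart 1 2 3 4, kite_chart 3 4 1 2, kite_chart 1 4 2 3, kite_chart 2 3 1 4}\<rparr>"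

end

theory Submission
  imports Defs
begin

text \<open>
  Suppose that the kite quasifold is diffeomorphic to the quotient of a manifold by a discrete group.
  The idea is to lift the diffeomorphism to the manifold over the charts at two opposite corners of the
  kite, and to see that the two lifts impose so many periods on one another that they are constant
  along a circle that contains uncountably many different points of the quasifold.

  A diffeomorphism of quasifolds lifts locally to homeomorphisms between open subsets of
  \<open>\<complex>\<^sup>2\<close> and of the manifold. The orbit projection of the manifold need not be a covering map, as
  orbits may be dense, but two local lifts that start at a common point still agree: compared in a
  chart of the kite, they differ by an element of a countable group that depends continuously on the
  point (\<open>chart_rigid_lift\<close>). The comparison needs nonzero coordinates; as the
  coordinate axes do not disconnect convex open sets, this suffices to glue local lifts to a lift over
  every convex open set contained in a chart (\<open>rigid_lift_unique_on_convex\<close>,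
  \<open>rigid_lift_exists_on_convex\<close>).

  The charts at the two opposite corners \<open>z\<^sub>1 = z\<^sub>2 = 0\<close> and \<open>z\<^sub>3 = z\<^sub>4 = 0\<close> both contain
  the polydisc of radius \<open>\<surd>\<sigma>\<close>, and the two polydiscs contain tori that represent the same points of the
  quasifold. Both tori are parametrized by the same plane. After a translation by the
  group of the manifold, the lifts over the two polydiscs therefore agree as functions on this plane.
  The first one is invariant under the periods of the first torus, the second one under those of the
  second torus. The first coordinate thus has the periods \<open>1\<close> and \<open>\<phi>\<close>, which generate
  a dense group, so the lift is constant in it (\<open>golden_periods_constant\<close>). Hence a whole circle
  in the first chart maps to one point of the quasifold, that is, lies in one orbit of the countable
  group of this chart, which is absurd.
\<close>

section \<open>Lifting through an orbit projection\<close>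

text \<open>
  A nontrivial connected metric space is uncountable. This is how the countability of the groups of
  the kite enters: two lifts of the same map differ pointwise by elements of a countable group, hence
  by a constant one.
\<close>

lemma continuous_countable_range_const:
  fixes f :: "'a::topological_space \<Rightarrow> 'b::metric_space"
  assumes "connected S" "continuous_on S f" "countable (f ` S)" "x \<in> S" "y \<in> S"
  shows "f x = f y"
  using assms connected_uncountable[of "f ` S" "f x" "f y"] connected_continuous_image by blast

definition off_axes :: "(complex \<times> complex) set" where
  "off_axes = {w. fst w \<noteq> 0 \<and> snd w \<noteq> 0}"

lemma open_meets_off_axes:
  assumes "open A" "w \<in> A"
  obtains u where "u \<in> A" "u \<in> off_axes"
proof -
  obtain B C where BC: "open B" "open C" "w \<in> B \<times> C" "B \<times> C \<subseteq> A"
    using assms by (rule open_prod_elim)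
  have ex: "\<exists>b\<in>S. b \<noteq> 0" if "open S" "c \<in> S" for S and c :: complex
  proof (rule ccontr)
    assume "\<not> ?thesis"
    with that have "S = {0}" by auto
    with that show False using not_open_singleton by metis
  qed
  obtain b where "b \<in> B" "b \<noteq> 0" using ex[OF BC(1)] BC(3) by (metis SigmaE2 prod.collapse)
  moreover obtain c where "c \<in> C" "c \<noteq> 0" using ex[OF BC(2)] BC(3) by (metis SigmaE2 prod.collapse)
  ultimately show thesis using BC(4) that[of "(b, c)"] by (auto simp: off_axes_def)
qed

text \<open>
  The projection \<open>q\<close> of a Hausdorff space onto the orbits of a group, given through a set of
  homeomorphisms that acts transitively on the fibres of \<open>q\<close>. Orbits may be dense, and then \<open>q\<close> is far
  from a covering map.
\<close>

locale orbit_projection =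
  fixes X :: "'b topology" and H :: "('b \<Rightarrow> 'b) set" and q :: "'b \<Rightarrow> 'y"
  assumes Hausdorff: "Hausdorff_space X"
    and homeo: "h \<in> H \<Longrightarrow> homeomorphic_map X X h"
    and proj_inv: "h \<in> H \<Longrightarrow> x \<in> topspace X \<Longrightarrow> q (h x) = q x"
    and fibre_transitive:
      "x \<in> topspace X \<Longrightarrow> y \<in> topspace X \<Longrightarrow> q x = q y \<Longrightarrow> \<exists>h\<in>H. h x = y"
begin

lemma inverse_proj:
  assumes "h \<in> H"
  obtains \<eta> where "homeomorphic_maps X X h \<eta>" "\<And>x. x \<in> topspace X \<Longrightarrow> q (\<eta> x) = q x"
proof -
  obtain \<eta> where \<eta>: "homeomorphic_maps X X h \<eta>"
    using homeo[OF assms] homeomorphic_map_maps by blast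
  then have \<eta>c: "continuous_map X X \<eta>" and \<eta>h: "\<And>y. y \<in> topspace X \<Longrightarrow> h (\<eta> y) = y"
    by (simp_all add: homeomorphic_maps_def)
  have "q (\<eta> x) = q x" if "x \<in> topspace X" for x
  proof -
    have "\<eta> x \<in> topspace X" "h (\<eta> x) = x"
      using continuous_map_image_subset_topspace[OF \<eta>c] \<eta>h that by blast+
    then show ?thesis using proj_inv[OF assms] by metis
  qed
  with \<eta> show thesis by (rule that)
qed

text \<open>
  As \<open>q\<close> need not be a covering map, lifts along it may lack unique continuation. A lift of \<open>e\<close> is rigid if
  continuation along it is unique wherever \<open>e\<close> is reached through points off the coordinate axes.
  There the groups that act on the charts of the kite have trivial stabilizers. The parameter
  space of the continuation is two-dimensional because it has to stay connected when the
  parameters of finitely many points are removed.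
\<close>

definition rigid_lift ::
    "(complex \<times> complex \<Rightarrow> 'y) \<Rightarrow> (complex \<times> complex) set \<Rightarrow> (complex \<times> complex \<Rightarrow> 'b) \<Rightarrow> bool" where
  "rigid_lift e A L \<longleftrightarrow>
     continuous_map (top_of_set A) X L \<and> (\<forall>w\<in>A. q (L w) = e w) \<and>
     (\<forall>(K::complex set) k h x0.
        open K \<and> x0 \<in> K \<and> continuous_on K k \<and> k ` K \<subseteq> A \<inter> off_axes \<and>
        continuous_map (top_of_set K) X h \<and> (\<forall>x\<in>K. q (h x) = e (k x)) \<and> h x0 = L (k x0) \<longrightarrow>
        (\<exists>K'. open K' \<and> x0 \<in> K' \<and> K' \<subseteq> K \<and> (\<forall>x\<in>K'. h x = L (k x))))"

lemma rigid_liftI: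
  assumes "continuous_map (top_of_set A) X L"
    and "\<And>w. w \<in> A \<Longrightarrow> q (L w) = e w"
    and "\<And>(K::complex set) k h x0.
      \<lbrakk>open K; x0 \<in> K; continuous_on K k; k ` K \<subseteq> A \<inter> off_axes; continuous_map (top_of_set K) X h;
       \<And>x. x \<in> K \<Longrightarrow> q (h x) = e (k x); h x0 = L (k x0)\<rbrakk> \<Longrightarrow>
      \<exists>K'. open K' \<and> x0 \<in> K' \<and> K' \<subseteq> K \<and> (\<forall>x\<in>K'. h x = L (k x))"
  shows "rigid_lift e A L"
  unfolding rigid_lift_def
proof (intro conjI allI impI)
  fix K :: "complex set" and k h x0
  assume a: "open K \<and> x0 \<in> K \<and> continuous_on K k \<and> k ` K \<subseteq> A \<inter> off_axes \<and>
    continuous_map (top_of_set K) X h \<and> (\<forall>x\<in>K. q (h x) = e (k x)) \<and> h x0 = L (k x0)"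
  show "\<exists>K'. open K' \<and> x0 \<in> K' \<and> K' \<subseteq> K \<and> (\<forall>x\<in>K'. h x = L (k x))"
    by (rule assms(3)) (use a in simp_all)
qed (use assms(1,2) in simp_all)

lemma rigid_lift_continuous: "rigid_lift e A L \<Longrightarrow> continuous_map (top_of_set A) X L"
  and rigid_lift_proj: "rigid_lift e A L \<Longrightarrow> w \<in> A \<Longrightarrow> q (L w) = e w"
  by (auto simp: rigid_lift_def)

lemma rigid_lift_topspace: "rigid_lift e A L \<Longrightarrow> w \<in> A \<Longrightarrow> L w \<in> topspace X"
  using continuous_map_image_subset_topspace[of "top_of_set A" X L] rigid_lift_continuous by fastforce

lemma rigid_lift_local_continuation:
  fixes K :: "complex set"
  assumes "rigid_lift e A L" "open K" "x0 \<in> K" "continuous_on K k" "k ` K \<subseteq> A \<inter> off_axes"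
    "continuous_map (top_of_set K) X h" "\<And>x. x \<in> K \<Longrightarrow> q (h x) = e (k x)" "h x0 = L (k x0)"
  obtains K' where "open K'" "x0 \<in> K'" "K' \<subseteq> K" "\<And>x. x \<in> K' \<Longrightarrow> h x = L (k x)"
proof -
  have "\<exists>K'. open K' \<and> x0 \<in> K' \<and> K' \<subseteq> K \<and> (\<forall>x\<in>K'. h x = L (k x))"
    using assms(1)[unfolded rigid_lift_def, THEN conjunct2, THEN conjunct2, rule_format, of K x0 k h]
      assms(2-) by simp
  then show thesis using that by metis
qed

lemma rigid_lift_mono:
  assumes "rigid_lift e A L" "B \<subseteq> A"
  shows "rigid_lift e B L"
proof (rule rigid_liftI)
  show "continuous_map (top_of_set B) X L"
    using assms rigid_lift_continuous continuous_map_from_subtopology_mono by blast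
  show "q (L w) = e w" if "w \<in> B" for w using that assms rigid_lift_proj by blast
next
  fix K :: "complex set" and k h x0
  assume a: "open K" "x0 \<in> K" "continuous_on K k" "k ` K \<subseteq> B \<inter> off_axes"
    "continuous_map (top_of_set K) X h" "\<And>x. x \<in> K \<Longrightarrow> q (h x) = e (k x)" "h x0 = L (k x0)"
  then have "k ` K \<subseteq> A \<inter> off_axes" using assms by blast
  from rigid_lift_local_continuation[OF assms(1) a(1-3) this a(5-7)]
  show "\<exists>K'. open K' \<and> x0 \<in> K' \<and> K' \<subseteq> K \<and> (\<forall>x\<in>K'. h x = L (k x))" by metis
qed

lemma continuous_map_top_of_set_cong:
  assumes "continuous_map (top_of_set A) X f" "\<And>x. x \<in> A \<Longrightarrow> f x = g x"
  shows "continuous_map (top_of_set A) X g"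
  using continuous_map_eq[OF assms(1)] assms(2) by simp

text \<open>Rigidity is a local property of a lift, so lifts that agree on overlaps can be glued.\<close>

lemma rigid_lift_local:
  assumes "\<And>w. w \<in> A \<Longrightarrow> \<exists>B L'. open B \<and> w \<in> B \<and> B \<subseteq> A \<and> rigid_lift e B L' \<and> (\<forall>u\<in>B. L u = L' u)"
  shows "rigid_lift e A L"
proof (rule rigid_liftI)
  obtain B where B: "\<And>w. w \<in> A \<Longrightarrow> open (B w) \<and> w \<in> B w \<and> B w \<subseteq> A \<and> continuous_map (top_of_set (B w)) X L"
    using assms continuous_map_top_of_set_cong rigid_lift_continuous by metis
  show "continuous_map (top_of_set A) X L"
  proof (rule pasting_lemma[where I = A and T = B and f = "\<lambda>_. L"])
    fix w assume w: "w \<in> A"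
    then show "openin (top_of_set A) (B w)" using B open_subset by blast
    have "A \<inter> B w = B w" using B w by blast
    then show "continuous_map (subtopology (top_of_set A) (B w)) X L"
      using B w by (simp add: subtopology_subtopology)
  qed (use B in auto)
  show "q (L w) = e w" if "w \<in> A" for w using assms[OF that] rigid_lift_proj by metis
next
  fix K :: "complex set" and k h x0
  assume a: "open K" "x0 \<in> K" "continuous_on K k" "k ` K \<subseteq> A \<inter> off_axes"
    "continuous_map (top_of_set K) X h" "\<And>x. x \<in> K \<Longrightarrow> q (h x) = e (k x)" "h x0 = L (k x0)"
  then have "k x0 \<in> A" by blast
  then obtain B L' where B: "open B" "k x0 \<in> B" "B \<subseteq> A" "rigid_lift e B L'" "\<And>u. u \<in> B \<Longrightarrow> L u = L' u"
    using assms by meson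
  define J where "J = K \<inter> k -` B"
  have "open J" unfolding J_def using a(1,3) B(1) continuous_on_open_vimage by (metis Int_commute)
  moreover have "J \<subseteq> K" by (auto simp: J_def)
  moreover have "x0 \<in> J" using a B by (simp add: J_def)
  moreover have "k ` J \<subseteq> B \<inter> off_axes" using a(4) by (auto simp: J_def)
  moreover have "continuous_on J k" using a(3) \<open>J \<subseteq> K\<close> continuous_on_subset by blast
  moreover have "continuous_map (top_of_set J) X h"
    using a(5) \<open>J \<subseteq> K\<close> continuous_map_from_subtopology_mono by blast
  moreover have "\<And>x. x \<in> J \<Longrightarrow> q (h x) = e (k x)" using a(6) by (auto simp: J_def)
  moreover have "h x0 = L' (k x0)" using a(7) B(2,5) by simp
  ultimately obtain K' where "open K'" "x0 \<in> K'" "K' \<subseteq> J" "\<And>x. x \<in> K' \<Longrightarrow> h x = L' (k x)"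
    using rigid_lift_local_continuation[OF B(4), of J x0 k h] by (metis (no_types, lifting))
  then show "\<exists>K'. open K' \<and> x0 \<in> K' \<and> K' \<subseteq> K \<and> (\<forall>x\<in>K'. h x = L (k x))"
    using B(5) by (auto simp: J_def intro!: exI[of _ K'])
qed

lemma rigid_lift_translate:
  assumes "rigid_lift e A L" "\<delta> \<in> H"
  shows "rigid_lift e A (\<delta> \<circ> L)"
proof (rule rigid_liftI)
  obtain \<eta> where \<eta>: "homeomorphic_maps X X \<delta> \<eta>" and q\<eta>: "\<And>x. x \<in> topspace X \<Longrightarrow> q (\<eta> x) = q x"
    using inverse_proj[OF assms(2)] by metis
  then have cont: "continuous_map X X \<delta>" "continuous_map X X \<eta>"
    and inv: "\<And>x. x \<in> topspace X \<Longrightarrow> \<eta> (\<delta> x) = x" "\<And>x. x \<in> topspace X \<Longrightarrow> \<delta> (\<eta> x) = x"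
    by (auto simp: homeomorphic_maps_def)
  show "continuous_map (top_of_set A) X (\<delta> \<circ> L)"
    using assms cont continuous_map_compose rigid_lift_continuous by blast
  show "q ((\<delta> \<circ> L) w) = e w" if "w \<in> A" for w
    using proj_inv[OF assms(2) rigid_lift_topspace[OF assms(1) that]] rigid_lift_proj[OF assms(1) that]
    by simp
  fix K :: "complex set" and k h x0
  assume a: "open K" "x0 \<in> K" "continuous_on K k" "k ` K \<subseteq> A \<inter> off_axes"
    "continuous_map (top_of_set K) X h" "\<And>x. x \<in> K \<Longrightarrow> q (h x) = e (k x)" "h x0 = (\<delta> \<circ> L) (k x0)"
  have hX: "h x \<in> topspace X" if "x \<in> K" for x
    using continuous_map_image_subset_topspace[OF a(5)] that by auto
  have LX: "L (k x) \<in> topspace X" if "x \<in> K" for x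
    using rigid_lift_topspace[OF assms(1)] a(4) that by blast
  have "(\<eta> \<circ> h) x0 = L (k x0)" using a(2,7) LX inv(1) by simp
  moreover have "q ((\<eta> \<circ> h) x) = e (k x)" if "x \<in> K" for x
    using that q\<eta> hX a(6) by simp
  moreover have "continuous_map (top_of_set K) X (\<eta> \<circ> h)"
    using a(5) cont(2) continuous_map_compose by blast
  ultimately obtain K' where K': "open K'" "x0 \<in> K'" "K' \<subseteq> K" "\<And>x. x \<in> K' \<Longrightarrow> (\<eta> \<circ> h) x = L (k x)"
    using rigid_lift_local_continuation[OF assms(1) a(1-4), of "\<eta> \<circ> h"] by (metis (no_types, lifting))
  have "h x = (\<delta> \<circ> L) (k x)" if "x \<in> K'" for x
    using K'(4)[OF that] inv(2) hX K'(3) that by (metis comp_apply subsetD)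
  then show "\<exists>K'. open K' \<and> x0 \<in> K' \<and> K' \<subseteq> K \<and> (\<forall>x\<in>K'. h x = (\<delta> \<circ> L) (k x))"
    using K' by blast
qed

text \<open>
  The set where two continuous lifts into a Hausdorff space agree is closed, and it is open by
  rigidity.
\<close>

lemma rigid_lift_continuation:
  fixes K :: "complex set"
  assumes L: "rigid_lift e A L" and K: "open K" "connected K" "x0 \<in> K" "continuous_on K k"
    and kK: "k ` K \<subseteq> A \<inter> off_axes"
    and h: "continuous_map (top_of_set K) X h" "\<And>x. x \<in> K \<Longrightarrow> q (h x) = e (k x)"
    and x0: "h x0 = L (k x0)" and x: "x \<in> K"
  shows "h x = L (k x)"
proof -
  let ?E = "{x \<in> K. h x = L (k x)}"
  have cont: "continuous_map (top_of_set K) X (L \<circ> k)"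
  proof (rule continuous_map_compose)
    show "continuous_map (top_of_set K) (top_of_set A) k"
      using K(4) kK by (simp add: continuous_map_in_subtopology continuous_map_iff_continuous)  blast
  qed (use L rigid_lift_continuous in blast)
  have "closedin (top_of_set K) ?E"
    using closedin_continuous_maps_eq[OF Hausdorff h(1) cont] by simp
  moreover have "openin (top_of_set K) ?E"
  proof -
    have "open ?E"
    proof (subst open_subopen, intro ballI)
      fix y assume "y \<in> ?E"
      then have y: "y \<in> K" "h y = L (k y)" by auto
      obtain K' where "open K'" "y \<in> K'" "K' \<subseteq> K" "\<And>x. x \<in> K' \<Longrightarrow> h x = L (k x)"
        using rigid_lift_local_continuation[OF L K(1) y(1) K(4) kK h y(2)] by metis
      then show "\<exists>T. open T \<and> y \<in> T \<and> T \<subseteq> ?E" by blast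
    qed
    then show ?thesis by (simp add: open_subset)
  qed
  ultimately have "?E = {} \<or> ?E = K" using K(2) connected_clopen by blast
  then show ?thesis using x0 K(3) x by blast
qed

text \<open>
  A convex open set meets the complex line from a point off the axes to any other point in a convex
  open subset of the line. At most two points of it lie on an axis, so it stays connected and dense
  without them, and continuation along it is unique.
\<close>

lemma rigid_lift_unique_on_convex:
  assumes A: "open A" "convex A" and L: "rigid_lift e A L" and L': "rigid_lift e A L'"
    and w0: "w0 \<in> A" "w0 \<in> off_axes" "L w0 = L' w0" and w: "w \<in> A"
  shows "L w = L' w"
proof -
  define k :: "complex \<Rightarrow> complex \<times> complex" where
    "k = (\<lambda>t. (fst w0 + t * (fst w - fst w0), snd w0 + t * (snd w - snd w0)))"
  have k01: "k 0 = w0" "k 1 = w" by (auto simp: k_def)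
  have kcont: "continuous_on S k" for S unfolding k_def by (intro continuous_intros)
  define K where "K = k -` A"
  have "open K" unfolding K_def using A(1) kcont[of UNIV] open_vimage by blast
  have "convex K"
  proof (rule convexI)
    fix s t :: complex and u v :: real
    assume st: "s \<in> K" "t \<in> K" "0 \<le> u" "0 \<le> v" "u + v = 1"
    then have v: "v = 1 - u" by simp
    have "k (u *\<^sub>R s + v *\<^sub>R t) = u *\<^sub>R k s + v *\<^sub>R k t"
      unfolding k_def v by (simp add: scaleR_conv_of_real algebra_simps)
    then show "u *\<^sub>R s + v *\<^sub>R t \<in> K" using convexD[OF A(2), of "k s" "k t" u v] st by (simp add: K_def)
  qed
  define B where "B = {t. k t \<notin> off_axes}"
  have lin: "finite {t. a + t * (b - a) = 0}" if "a \<noteq> 0" for a b :: complex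
  proof (cases "b = a")
    case False
    then have "{t. a + t * (b - a) = 0} \<subseteq> {- a / (b - a)}" by (auto simp: field_simps eq_neg_iff_add_eq_0)
    then show ?thesis using finite_subset by blast
  qed (use that in simp)
  have "B = {t. fst w0 + t * (fst w - fst w0) = 0} \<union> {t. snd w0 + t * (snd w - snd w0) = 0}"
    by (auto simp: B_def off_axes_def k_def)
  then have finB: "finite B" using lin w0(2) by (simp add: off_axes_def)
  have KB: "open (K - B)" "connected (K - B)"
    using \<open>open K\<close> finB finite_imp_closed apply blast
    using connected_open_delete_finite[OF \<open>open K\<close> convex_connected[OF \<open>convex K\<close>] _ finB] by simp
  have comp: "continuous_map (top_of_set K) X (M \<circ> k)" if "rigid_lift e A M" for M
  proof (rule continuous_map_compose)
    show "continuous_map (top_of_set K) (top_of_set A) k"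
      using kcont by (auto simp: continuous_map_in_subtopology continuous_map_iff_continuous K_def)
  qed (use that rigid_lift_continuous in blast)
  have eq: "(L \<circ> k) t = (L' \<circ> k) t" if "t \<in> K - B" for t
  proof -
    have "(L \<circ> k) t = L' (k t)"
    proof (rule rigid_lift_continuation[OF L' KB])
      show "0 \<in> K - B" using k01 w0 by (simp add: K_def B_def)
      show "k ` (K - B) \<subseteq> A \<inter> off_axes" by (auto simp: K_def B_def)
      show "continuous_map (top_of_set (K - B)) X (L \<circ> k)"
        using comp[OF L] continuous_map_from_subtopology_mono Diff_subset by blast
      show "q ((L \<circ> k) x) = e (k x)" if "x \<in> K - B" for x
        using that rigid_lift_proj[OF L] by (simp add: K_def)
    qed (use that kcont k01 w0 in auto)
    then show ?thesis by simp
  qed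
  have "1 \<in> K" using w k01 by (simp add: K_def)
  then have "1 islimpt K" using \<open>open K\<close> open_imp_islimpt by blast
  moreover have "K \<subseteq> B \<union> (K - B)" by blast
  ultimately have "1 islimpt (K - B)" using finB islimpt_Un_finite islimpt_subset by metis
  then have "1 \<in> closure (K - B)" by (simp add: closure_def)
  then have "1 \<in> (top_of_set K) closure_of (K - B)"
    using \<open>1 \<in> K\<close> by (simp add: closure_of_subtopology Int_absorb1)
  from forall_in_closure_of_eq[OF this Hausdorff comp[OF L] comp[OF L'] eq]
  show ?thesis by (simp add: k01)
qed

text \<open>
  A lift is continued from \<open>w0\<close> along the segments to all other points of \<open>D\<close>. Each lift is kept on a
  convex neighbourhood of the segment. Two such neighbourhoods intersect in a convex set that
  contains \<open>w0\<close>, so the lifts over them agree and define a single one.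
\<close>

lemma rigid_lift_exists_on_convex:
  assumes D: "open D" "convex D" "w0 \<in> D" "w0 \<in> off_axes"
    and loc: "\<And>w. w \<in> D \<Longrightarrow> \<exists>A L. open A \<and> w \<in> A \<and> rigid_lift e A L"
  obtains L where "rigid_lift e D L"
proof -
  obtain A0 L0 where A0: "open A0" "w0 \<in> A0" "rigid_lift e A0 L0" using loc D(3) by blast
  define y0 where "y0 = L0 w0"
  define seg :: "complex \<times> complex \<Rightarrow> real \<Rightarrow> (complex \<times> complex) set" where
    "seg = (\<lambda>w s. (\<lambda>t. w0 + t *\<^sub>R (w - w0)) ` {0..s})"
  have seg_compact: "compact (seg w s)" for w s
    unfolding seg_def by (intro compact_continuous_image continuous_intros) simp
  have seg_convex: "convex (seg w s)" for w s
  proof -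
    have "seg w s = (+) w0 ` ((\<lambda>t. t *\<^sub>R (w - w0)) ` {0..s})" by (auto simp: seg_def)
    moreover have "convex ((\<lambda>t. t *\<^sub>R (w - w0)) ` {0..s})"
      by (intro convex_linear_image convex_real_interval) (simp add: linear_iff scaleR_add_left)
    ultimately show ?thesis using convex_translation by metis
  qed
  \<comment> \<open>Continuation is possible up to the parameter \<open>s\<close> on the segment.\<close>
  define P where "P = (\<lambda>w s. \<exists>A L. open A \<and> convex A \<and> w0 \<in> A \<and> seg w s \<subseteq> A \<and> rigid_lift e A L \<and> L w0 = y0)"
  have P0: "P w 0" for w
  proof -
    obtain r where r: "r > 0" "ball w0 r \<subseteq> A0" using A0 open_contains_ball by blast
    then have "rigid_lift e (ball w0 r) L0" using A0(3) rigid_lift_mono by blast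
    then show ?thesis unfolding P_def seg_def y0_def using r
      by (intro exI[of _ "ball w0 r"] exI[of _ L0]) auto
  qed
  have step: "\<exists>r>0. \<forall>s1\<in>{0..1}. \<forall>s2\<in>{0..1}. \<bar>s1 - s\<bar> < r \<and> \<bar>s2 - s\<bar> < r \<and> P w s1 \<longrightarrow> P w s2"
    if w: "w \<in> D" and s: "s \<in> {0..1}" for w s
  proof -
    define c where "c = w0 + s *\<^sub>R (w - w0)"
    have "c = (1 - s) *\<^sub>R w0 + s *\<^sub>R w" unfolding c_def by (simp add: algebra_simps)
    then have "c \<in> D" using convexD[OF D(2,3) w, of "1 - s" s] s by simp
    then obtain B0 M0 where B0: "open B0" "c \<in> B0" "rigid_lift e B0 M0" using loc by blast
    obtain \<rho> where \<rho>: "\<rho> > 0" "ball c \<rho> \<subseteq> B0" using B0 open_contains_ball by blast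
    define B where "B = ball c \<rho>"
    have B: "open B" "convex B" "rigid_lift e B M0"
      using B0(3) \<rho> rigid_lift_mono by (auto simp: B_def)
    define r where "r = \<rho> / (1 + norm (w - w0))"
    have np: "1 + norm (w - w0) > 0" by (smt (verit) norm_ge_zero)
    have r: "r > 0" using \<rho> np by (simp add: r_def)
    have inB: "w0 + t *\<^sub>R (w - w0) \<in> B" if "\<bar>t - s\<bar> < r" for t
    proof -
      have "dist c (w0 + t *\<^sub>R (w - w0)) = norm ((s - t) *\<^sub>R (w - w0))"
        by (simp add: c_def dist_norm algebra_simps)
      also have "\<dots> \<le> \<bar>t - s\<bar> * (1 + norm (w - w0))" by (simp add: abs_minus_commute mult_left_mono)
      also have "\<dots> < r * (1 + norm (w - w0))" using that np by simp
      also have "\<dots> = \<rho>" using np by (simp add: r_def)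
      finally show ?thesis by (simp add: B_def)
    qed
    have "P w s2" if s1: "s1 \<in> {0..1}" "\<bar>s1 - s\<bar> < r" and s2: "s2 \<in> {0..1}" "\<bar>s2 - s\<bar> < r" and "P w s1" for s1 s2
    proof -
      obtain A L where A: "open A" "convex A" "w0 \<in> A" "seg w s1 \<subseteq> A" "rigid_lift e A L" "L w0 = y0"
        using \<open>P w s1\<close> by (auto simp: P_def)
      have "w0 + s1 *\<^sub>R (w - w0) \<in> seg w s1" using s1 by (auto simp: seg_def)
      then have "w0 + s1 *\<^sub>R (w - w0) \<in> A \<inter> B" using A(4) inB s1 by blast
      then obtain u where u: "u \<in> A \<inter> B" "u \<in> off_axes"
        using open_meets_off_axes[OF open_Int[OF A(1) B(1)]] by metis
      have "q (M0 u) = q (L u)" using u A(5) B(3) rigid_lift_proj by (metis IntE)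
      then obtain \<delta> where \<delta>: "\<delta> \<in> H" "\<delta> (M0 u) = L u"
        using fibre_transitive rigid_lift_topspace[OF B(3)] rigid_lift_topspace[OF A(5)] u by blast
      define M where "M = \<delta> \<circ> M0"
      have M: "rigid_lift e B M" using rigid_lift_translate[OF B(3) \<delta>(1)] by (simp add: M_def)
      have LM: "L u = M u" using \<delta>(2) by (simp add: M_def)
      have agree: "L v = M v" if "v \<in> A \<inter> B" for v
        by (rule rigid_lift_unique_on_convex[where A = "A \<inter> B" and e = e])
           (use A B M u LM that in \<open>auto intro: convex_Int rigid_lift_mono\<close>)
      define N where "N = (\<lambda>v. if v \<in> A then L v else M v)"
      have N: "rigid_lift e (A \<union> B) N"
      proof (rule rigid_lift_local)
        fix v assume "v \<in> A \<union> B"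
        then consider "v \<in> A" | "v \<in> B" by blast
        then show "\<exists>S L'. open S \<and> v \<in> S \<and> S \<subseteq> A \<union> B \<and> rigid_lift e S L' \<and> (\<forall>u\<in>S. N u = L' u)"
        proof cases
          case 1 then show ?thesis using A by (intro exI[of _ A] exI[of _ L]) (auto simp: N_def)
        next
          case 2 then show ?thesis using B M agree by (intro exI[of _ B] exI[of _ M]) (auto simp: N_def)
        qed
      qed
      have sub: "seg w s2 \<subseteq> A \<union> B"
      proof
        fix v assume "v \<in> seg w s2"
        then obtain t where t: "0 \<le> t" "t \<le> s2" "v = w0 + t *\<^sub>R (w - w0)" by (auto simp: seg_def)
        show "v \<in> A \<union> B"
        proof (cases "t \<le> s1")
          case True
          then have "v \<in> seg w s1" using t by (auto simp: seg_def)
          then show ?thesis using A(4) by blast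
        next
          case False then have "\<bar>t - s\<bar> < r" using s1 s2 t by auto
          then show ?thesis using inB t by blast
        qed
      qed
      \<comment> \<open>The union is not convex, but it contains a tube around the compact segment.\<close>
      obtain \<epsilon> where \<epsilon>: "\<epsilon> > 0" "(\<Union>x\<in>seg w s2. ball x \<epsilon>) \<subseteq> A \<union> B"
        using compact_subset_open_imp_ball_epsilon_subset[OF seg_compact open_Un[OF A(1) B(1)] sub] by metis
      define T where "T = (\<Union>x\<in>seg w s2. ball x \<epsilon>)"
      have "T = (\<Union>x\<in>seg w s2. \<Union>y\<in>ball 0 \<epsilon>. {x + y})"
      proof -
        have "(\<Union>y\<in>ball 0 \<epsilon>. {x + y}) = (+) x ` ball 0 \<epsilon>" for x :: "complex \<times> complex"
          by (rule UNION_singleton_eq_range)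
        then have "(\<Union>y\<in>ball 0 \<epsilon>. {x + y}) = ball x \<epsilon>" for x :: "complex \<times> complex"
          using image_add_ball[of x 0 \<epsilon>] by simp
        then show ?thesis by (simp add: T_def)
      qed
      then have "convex T" using convex_sums[OF seg_convex convex_ball] by metis
      moreover have "open T" by (auto simp: T_def)
      moreover have segT: "seg w s2 \<subseteq> T" using \<epsilon>(1) by (auto simp: T_def)
      moreover have "w0 \<in> seg w s2" using s2 by (auto simp: seg_def intro!: image_eqI[of _ _ 0])
      moreover have "rigid_lift e T N" using N \<epsilon>(2) rigid_lift_mono unfolding T_def by blast
      moreover have "N w0 = y0" using A by (simp add: N_def)
      ultimately show ?thesis unfolding P_def by blast
    qed
    then show ?thesis using r by blast
  qed
  have P1: "P w 1" if w: "w \<in> D" for w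
  proof -
    have "P w 0 = P w 1"
    proof (rule connected_local_const[of "{0..1::real}"])
      show "\<forall>s\<in>{0..1}. \<forall>\<^sub>F b in at s within {0..1}. P w s = P w b"
      proof
        fix s :: real assume s: "s \<in> {0..1}"
        obtain r where r: "r > 0" "\<And>s1 s2. \<lbrakk>s1 \<in> {0..1}; s2 \<in> {0..1}; \<bar>s1 - s\<bar> < r; \<bar>s2 - s\<bar> < r; P w s1\<rbrakk> \<Longrightarrow> P w s2"
          using step[OF w s] by blast
        have "P w s = P w b" if "b \<in> {0..1}" "dist b s < r" for b
          using r(2)[of s b] r(2)[of b s] r(1) s that unfolding dist_real_def by fastforce
        then show "\<forall>\<^sub>F b in at s within {0..1}. P w s = P w b"
          unfolding eventually_at using r(1) by blast
      qed
    qed auto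
    then show ?thesis using P0 by simp
  qed
  then obtain T G where TG: "\<And>w. w \<in> D \<Longrightarrow> open (T w) \<and> convex (T w) \<and> w0 \<in> T w \<and> seg w 1 \<subseteq> T w \<and>
      rigid_lift e (T w) (G w) \<and> G w w0 = y0"
    unfolding P_def by metis
  have inT: "w \<in> T w" if "w \<in> D" for w
  proof -
    have "w \<in> seg w 1" by (auto simp: seg_def intro!: image_eqI[of _ _ 1])
    then show ?thesis using TG that by blast
  qed
  have "rigid_lift e D (\<lambda>w. G w w)"
  proof (rule rigid_lift_local)
    fix w assume w: "w \<in> D"
    have "G u u = G w u" if u: "u \<in> T w \<inter> D" for u
      by (rule rigid_lift_unique_on_convex[where A = "T u \<inter> T w" and e = e and ?w0.0 = w0])
         (use TG[OF w] TG[of u] inT[of u] u D in \<open>auto intro: convex_Int rigid_lift_mono\<close>)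
    then show "\<exists>B L'. open B \<and> w \<in> B \<and> B \<subseteq> D \<and> rigid_lift e B L' \<and> (\<forall>u\<in>B. G u u = L' u)"
      using TG[OF w] inT[OF w] w D(1)
      by (intro exI[of _ "T w \<inter> D"] exI[of _ "G w"]) (auto intro: rigid_lift_mono)
  qed
  then show thesis by (rule that)
qed

end

section \<open>The corners of the kite\<close>

lemma golden_pos: "golden > 0" and golden_gt_1: "golden > 1"
  and golden_square: "golden * golden = golden + 1"
proof -
  have "sqrt 5 > 1" by simp
  then show "golden > 1" by (simp add: golden_def)
  then show "golden > 0" by simp
  show "golden * golden = golden + 1"
    by (simp add: golden_def field_simps)
qed

lemma inverse_golden: "1 / golden = golden - 1"
  using golden_pos golden_square by (simp add: field_simps)

lemma golden_less_2: "golden < 2"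
proof (rule ccontr)
  assume "\<not> golden < 2"
  then have "2 * golden \<le> golden * golden" using golden_pos by simp
  then have "golden \<le> 1" using golden_square by simp
  then show False using golden_gt_1 by simp
qed

lemma kite_sigma_pos: "kite_sigma > 0"
  using golden_pos by (simp add: kite_sigma_def)

text \<open>The parametrization of the Lie algebra of \<open>N\<close>.\<close>

definition wind :: "real \<Rightarrow> real \<Rightarrow> real ^ 4" where
  "wind s t = vector [- s + golden * t, s, t, - t + golden * s]"

lemma wind_nth [simp]:
  "wind s t $ 1 = - s + golden * t" "wind s t $ 2 = s" "wind s t $ 3 = t"
  "wind s t $ 4 = - t + golden * s"
  by (simp_all add: wind_def vector_def)

lemma wind_add: "wind s t + wind s' t' = wind (s + s') (t + t')"
  by (simp add: vec_eq_iff forall_4 algebra_simps)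

lemma kite_N_wind: "kite_N = {torus_exp (wind s t) | s t. True}"
  by (simp add: kite_N_def wind_def)

lemma torus_exp_nth [simp]: "torus_exp \<theta> $ m = cis (2 * pi * \<theta> $ m)"
  by (simp add: torus_exp_def)

lemma torus_act_nth [simp]: "torus_act u z $ m = u $ m * z $ m"
  by (simp add: torus_act_def)

lemma torus_act_exp_exp: "torus_act (torus_exp \<theta>) (torus_act (torus_exp \<theta>') z) = torus_act (torus_exp (\<theta> + \<theta>')) z"
  by (simp add: vec_eq_iff cis_mult[symmetric] algebra_simps)

lemma torus_exp_0: "torus_act (torus_exp 0) z = z"
  by (simp add: vec_eq_iff)

lemma wind_0: "wind 0 0 = 0"
  by (simp add: vec_eq_iff forall_4)

lemma kite_class_eq: "kite_class z = {torus_act (torus_exp (wind s t)) z | s t. True}"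
  by (auto simp: orbit_def kite_group_def kite_N_wind)

lemma in_kite_class: "torus_act (torus_exp (wind s t)) z \<in> kite_class z"
  by (auto simp: kite_class_eq)

lemma kite_class_wind: "kite_class (torus_act (torus_exp (wind s t)) z) = kite_class z"
proof -
  have "\<exists>s' t'. torus_act (torus_exp (wind u v)) z =
      torus_act (torus_exp (wind s' t')) (torus_act (torus_exp (wind s t)) z)" for u v
    by (rule exI[of _ "u - s"], rule exI[of _ "v - t"]) (simp add: torus_act_exp_exp wind_add)
  then show ?thesis
    by (auto simp: kite_class_eq torus_act_exp_exp wind_add) 
qed

lemma kite_class_eq_iff:
  "kite_class z = kite_class z' \<longleftrightarrow> (\<exists>s t. z' = torus_act (torus_exp (wind s t)) z)"
proof
  assume "kite_class z = kite_class z'"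
  moreover have "z' \<in> kite_class z'" using in_kite_class[of 0 0 z'] by (simp add: wind_0 torus_exp_0)
  ultimately have "z' \<in> kite_class z" by simp
  then show "\<exists>s t. z' = torus_act (torus_exp (wind s t)) z" unfolding kite_class_eq by blast
qed (auto simp: kite_class_wind)

lemma kite_level_torus: "torus_act (torus_exp \<theta>) z \<in> kite_level \<longleftrightarrow> z \<in> kite_level"
  by (simp add: kite_level_def kite_Psi_def norm_mult)

text \<open>
  The data of a chart at the corner of the kite where the facets \<open>i\<close> and \<open>j\<close> meet: on the level set,
  the coordinates \<open>i, j\<close> determine the absolute values of the coordinates \<open>k, l\<close>, and an element of
  the Lie algebra of \<open>N\<close> is determined by its components \<open>k, l\<close>, which are arbitrary.
\<close>

locale kite_corner =
  fixes i j k l :: 4 and P Q :: "complex \<times> complex \<Rightarrow> real" and a b c d :: real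
  assumes distinct: "distinct [i, j, k, l]"
    and cont: "continuous_on UNIV P" "continuous_on UNIV Q"
    and level: "z \<in> kite_level \<longleftrightarrow> (cmod (z $ k))\<^sup>2 = P (z $ i, z $ j) \<and> (cmod (z $ l))\<^sup>2 = Q (z $ i, z $ j)"
    and wind: "wind s t $ k = x \<and> wind s t $ l = y \<longleftrightarrow> s = a * x + b * y \<and> t = c * x + d * y"
begin

lemma indices: "m = i \<or> m = j \<or> m = k \<or> m = l"
proof -
  have "card {i, j, k, l} = 4" using distinct by simp
  then have "{i, j, k, l} = UNIV" by (intro card_subset_eq) auto
  then show ?thesis by blast
qed

lemma vec_eq: "z = z' \<longleftrightarrow> z $ i = z' $ i \<and> z $ j = z' $ j \<and> z $ k = z' $ k \<and> z $ l = z' $ l"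
proof
  assume r: "z $ i = z' $ i \<and> z $ j = z' $ j \<and> z $ k = z' $ k \<and> z $ l = z' $ l"
  show "z = z'" unfolding vec_eq_iff
  proof
    show "z $ m = z' $ m" for m using indices[of m] r by auto
  qed
qed simp

text \<open>An explicit and total function that agrees with \<open>kite_lift i j k l\<close> on \<open>kite_U i j k l\<close>.\<close>

definition sec :: "complex \<times> complex \<Rightarrow> complex ^ 4" where
  "sec w = (\<chi> m. if m = i then fst w else if m = j then snd w
                 else of_real (if m = k then sqrt (P w) else sqrt (Q w)))"

lemma sec_nth [simp]:
  "sec w $ i = fst w" "sec w $ j = snd w" "sec w $ k = of_real (sqrt (P w))" "sec w $ l = of_real (sqrt (Q w))"
  using distinct by (auto simp: sec_def)

lemma kite_lift_of_iff: "kite_lift_of i j k l w z \<longleftrightarrow> P w > 0 \<and> Q w > 0 \<and> z = sec w"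
proof
  assume "kite_lift_of i j k l w z"
  then obtain r s where "z \<in> kite_level" "z $ i = fst w" "z $ j = snd w" "r > 0" "z $ k = of_real r"
    "s > 0" "z $ l = of_real s"
    by (auto simp: kite_lift_of_def)
  moreover from this have "r\<^sup>2 = P w" "s\<^sup>2 = Q w" by (auto simp: level)
  moreover from this have "r = sqrt (P w)" "s = sqrt (Q w)"
    using \<open>r > 0\<close> \<open>s > 0\<close> real_sqrt_unique by (metis less_imp_le)+
  ultimately show "P w > 0 \<and> Q w > 0 \<and> z = sec w" 
    by (auto simp: vec_eq) 
next
  assume "P w > 0 \<and> Q w > 0 \<and> z = sec w"
  moreover from this have "\<exists>r>0. complex_of_real (sqrt (P w)) = of_real r" 
    "\<exists>r>0. complex_of_real (sqrt (Q w)) = of_real r"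
    using real_sqrt_gt_zero by blast+
  ultimately show "kite_lift_of i j k l w z"
    by (simp add: kite_lift_of_def level)
qed

lemma U_eq: "kite_U i j k l = {w. P w > 0 \<and> Q w > 0}"
  by (auto simp: kite_U_def kite_lift_of_iff)

lemma open_U: "open (kite_U i j k l)"
  unfolding U_eq by (intro open_Collect_conj open_Collect_less continuous_on_const cont)

lemma kite_lift_eq: "w \<in> kite_U i j k l \<Longrightarrow> kite_lift i j k l w = sec w"
  unfolding kite_lift_def U_eq by (rule the_equality) (auto simp: kite_lift_of_iff)

lemma sec_level: "w \<in> kite_U i j k l \<Longrightarrow> sec w \<in> kite_level"
  by (auto simp: U_eq level)

lemma continuous_sec: "continuous_on S sec"
proof -
  have "continuous_on S P" "continuous_on S Q" using cont continuous_on_subset by blast+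
  then have "continuous_on S (\<lambda>w. complex_of_real (sqrt (P w)))"
    "continuous_on S (\<lambda>w. complex_of_real (sqrt (Q w)))"
    "continuous_on S (fst :: complex \<times> complex \<Rightarrow> _)" "continuous_on S (snd :: complex \<times> complex \<Rightarrow> _)"
    by (auto intro!: continuous_intros)
  then have "continuous_on S (\<lambda>w. sec w $ m)" for m
    using indices[of m] by (elim disjE) simp_all
  then have "continuous_on S (\<lambda>w. \<chi> m. sec w $ m)" by (intro continuous_on_vec_lambda)
  then show ?thesis by simp
qed

lemma countable_Gamma: "countable {u \<in> kite_N. u $ k = 1 \<and> u $ l = 1}"
proof (rule countable_subset)
  let ?f = "\<lambda>(x, y). torus_exp (wind (a * of_int x + b * of_int y) (c * of_int x + d * of_int y))"
  show "{u \<in> kite_N. u $ k = 1 \<and> u $ l = 1} \<subseteq> range ?f"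
  proof clarify
    fix u assume "u \<in> kite_N" "u $ k = 1" "u $ l = 1"
    then obtain s t where u: "u = torus_exp (wind s t)" by (auto simp: kite_N_wind)
    then have "cis (2 * pi * wind s t $ k) = 1" "cis (2 * pi * wind s t $ l) = 1"
      using \<open>u $ k = 1\<close> \<open>u $ l = 1\<close> by auto
    then have "cos (2 * pi * wind s t $ k) = 1" "cos (2 * pi * wind s t $ l) = 1"
      by (simp_all add: complex_eq_iff)
    then obtain x y :: int where "wind s t $ k = of_int x" "wind s t $ l = of_int y"
      unfolding cos_one_2pi_int by auto
    then have "s = a * of_int x + b * of_int y \<and> t = c * of_int x + d * of_int y"
      using wind by blast
    then show "u \<in> range ?f" unfolding u by (intro image_eqI[of _ _ "(x, y)"]) auto
  qed
qed simp

text \<open>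
  An element of \<open>N\<close> that maps one point of the image of \<open>sec\<close> to another one fixes their positive
  coordinates \<open>k, l\<close>, so it lies in the group of the chart.
\<close>

lemma same_class:
  assumes w: "w \<in> kite_U i j k l" and w': "w' \<in> kite_U i j k l"
    and eq: "kite_class (sec w) = kite_class (sec w')"
  obtains u where "u \<in> kite_N" "u $ k = 1" "u $ l = 1" "w' = (u $ i * fst w, u $ j * snd w)"
proof -
  obtain s t where st: "sec w' = torus_act (torus_exp (wind s t)) (sec w)"
    using eq kite_class_eq_iff by blast
  define u where "u = torus_exp (wind s t)"
  have one: "x = 1" if "complex_of_real r' = x * of_real r" "cmod x = 1" "r > 0" "r' > 0" for x r r'
  proof -
    have "cmod (complex_of_real r') = cmod (x * of_real r)" using that(1) by simp
    then have "r = r'" using that(2-4) by (simp add: norm_mult)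
    then show ?thesis using that by simp
  qed
  have nth: "sec w' $ m = u $ m * sec w $ m" for m using st by (simp add: u_def)
  have "u $ k = 1"
    by (rule one[OF nth[of k, unfolded sec_nth]]) (use w w' in \<open>simp_all add: U_eq u_def\<close>)
  moreover have "u $ l = 1"
    by (rule one[OF nth[of l, unfolded sec_nth]]) (use w w' in \<open>simp_all add: U_eq u_def\<close>)
  moreover have "w' = (u $ i * fst w, u $ j * snd w)" using nth[of i] nth[of j] by (simp add: prod_eq_iff)
  ultimately show thesis using that[of u] by (auto simp: u_def kite_N_wind)
qed

text \<open>
  Every point of the level set can be moved by \<open>N\<close> into the image of the chart where its coordinates
  \<open>k, l\<close> do not vanish, and the winding that makes them positive can be chosen continuously near a
  given point.
\<close>

lemma slice:
  assumes w: "w \<in> kite_U i j k l" and z: "z \<in> kite_level" and eq: "kite_class (sec w) = kite_class z"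
  obtains S T where "open S" "z \<in> S" "continuous_on S T" "T z = w"
    "\<And>y. y \<in> S \<inter> kite_level \<Longrightarrow> T y \<in> kite_U i j k l \<and> kite_class (sec (T y)) = kite_class y"
    "\<And>y. (\<forall>m. y $ m \<noteq> 0) \<Longrightarrow> T y \<in> off_axes"
proof -
  obtain s0 t0 where st0: "sec w = torus_act (torus_exp (wind s0 t0)) z"
    using eq kite_class_eq_iff by metis
  define Y where "Y = torus_act (torus_exp (wind s0 t0))"
  have Yw: "Y z = sec w" using st0 by (simp add: Y_def)
  have Ycont: "continuous_on R (\<lambda>y. Y y $ m)" for R m
    by (auto simp: Y_def intro!: continuous_intros)
  define S where "S = {y. Re (Y y $ k) > 0 \<and> Re (Y y $ l) > 0}"
  define \<alpha> where "\<alpha> = (\<lambda>y. - Im (Ln (Y y $ k)) / (2 * pi))"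
  define \<beta> where "\<beta> = (\<lambda>y. - Im (Ln (Y y $ l)) / (2 * pi))"
  define V where "V = (\<lambda>y. wind (a * \<alpha> y + b * \<beta> y) (c * \<alpha> y + d * \<beta> y))"
  have Vkl: "V y $ k = \<alpha> y \<and> V y $ l = \<beta> y" for y unfolding V_def by (subst wind) simp
  define Z where "Z = (\<lambda>y. torus_act (torus_exp (V y)) (Y y))"
  define T where "T = (\<lambda>y. (Z y $ i, Z y $ j))"
  have pos: "cis (2 * pi * (- Im (Ln x) / (2 * pi))) * x = of_real (cmod x)" if "Re x > 0" for x
  proof -
    have "x \<noteq> 0" using that by auto
    then have "x = of_real (cmod x) * cis (Im (Ln x))"
      by (metis Arg_eq Arg_def cis_conv_exp mult.commute exp_Ln exp_eq_polar norm_exp_eq_Re)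
    then have "cis (- Im (Ln x)) * x = of_real (cmod x) * (cis (- Im (Ln x)) * cis (Im (Ln x)))"
      by (metis mult.assoc mult.commute)
    then show ?thesis by (simp add: cis_mult)
  qed
  have Zkl: "Z y $ k = of_real (cmod (Y y $ k))" "Z y $ l = of_real (cmod (Y y $ l))" if "y \<in> S" for y
    using pos[of "Y y $ k"] pos[of "Y y $ l"] that Vkl[of y] by (auto simp: Z_def S_def \<alpha>_def \<beta>_def)
  show thesis
  proof
    show "open S" unfolding S_def
      by (intro open_Collect_conj open_Collect_less continuous_intros Ycont)
    show "z \<in> S" using w by (simp add: S_def Yw U_eq)
    have "continuous_on S \<alpha>" "continuous_on S \<beta>" unfolding \<alpha>_def \<beta>_def
      by (auto intro!: continuous_intros Ycont simp: S_def complex_nonpos_Reals_iff)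
    then have Vm: "continuous_on S (\<lambda>y. V y $ m)" for m
      using exhaust_4[of m] unfolding V_def
      by (elim disjE; simp) (intro continuous_intros; assumption)+
    have Zm: "continuous_on S (\<lambda>y. Z y $ m)" for m
      unfolding Z_def torus_act_nth torus_exp_nth
      by (intro continuous_on_mult continuous_on_cis continuous_on_const Ycont Vm)
    show "continuous_on S T" unfolding T_def by (intro continuous_on_Pair Zm)
    have "V z = 0"
    proof -
      have "\<alpha> z = 0" "\<beta> z = 0"
        using w by (auto simp: \<alpha>_def \<beta>_def Yw U_eq Ln_of_real)
      then show ?thesis by (simp add: V_def wind_0)
    qed
    then show "T z = w" by (simp add: T_def Z_def Yw torus_exp_0 prod_eq_iff)
    show "T y \<in> kite_U i j k l \<and> kite_class (sec (T y)) = kite_class y" if y: "y \<in> S \<inter> kite_level" for y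
    proof -
      have Z: "Z y \<in> kite_level" using y by (simp add: Z_def Y_def kite_level_torus)
      have pk: "cmod (Y y $ k) > 0" "cmod (Y y $ l) > 0" using y by (auto simp: S_def)
      have "\<exists>r>0. Z y $ k = of_real r" "\<exists>r>0. Z y $ l = of_real r"
        using Zkl[of y] y pk by blast+
      then have "kite_lift_of i j k l (T y) (Z y)"
        using Z by (simp add: kite_lift_of_def T_def)
      then have "T y \<in> kite_U i j k l" "Z y = sec (T y)" by (auto simp: kite_U_def kite_lift_of_iff)
      moreover have "kite_class (Z y) = kite_class y"
        by (simp add: Z_def Y_def V_def kite_class_wind)
      ultimately show ?thesis by simp
    qed
    show "T y \<in> off_axes" if "\<forall>m. y $ m \<noteq> 0" for y
      using that by (simp add: T_def off_axes_def Z_def Y_def)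
  qed
qed

end

section \<open>Global quotients and coverings\<close>

lemma smooth_manifold_locally_connected:
  assumes "smooth_manifold M"
  shows "locally_connected_space (mtop M)"
  unfolding locally_connected_space
proof (intro allI impI)
  fix V x assume V: "openin (mtop M) V \<and> x \<in> V"
  then have "x \<in> pts M" using openin_subset by blast
  then have "x \<in> (\<Union>c\<in>matlas M. fst c)" using assms by (simp add: smooth_manifold_def)
  then obtain U \<phi> where U: "(U, \<phi>) \<in> matlas M" "x \<in> U" by fastforce
  then have oU: "openin (mtop M) U" and o\<phi>: "open (\<phi> ` U)"
    and h: "homeomorphic_map (subtopology (mtop M) U) (top_of_set (\<phi> ` U)) \<phi>"
    using assms by (auto simp: smooth_manifold_def coordinates_def)
  have tU: "topspace (subtopology (mtop M) U) = U" using openin_subset[OF oU] by auto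
  obtain g where g: "homeomorphic_maps (subtopology (mtop M) U) (top_of_set (\<phi> ` U)) \<phi> g"
    using h homeomorphic_map_maps by blast
  then have gh: "homeomorphic_map (top_of_set (\<phi> ` U)) (subtopology (mtop M) U) g"
    and g\<phi>: "\<And>y. y \<in> U \<Longrightarrow> g (\<phi> y) = y"
    unfolding homeomorphic_maps_map tU by blast+
  have gc: "continuous_map (top_of_set (\<phi> ` U)) (subtopology (mtop M) U) g"
    using gh homeomorphic_imp_continuous_map by blast
  have "openin (subtopology (mtop M) U) (U \<inter> V)" using V by (simp add: openin_subtopology_Int2)
  then have "openin (top_of_set (\<phi> ` U)) (\<phi> ` (U \<inter> V))"
    using homeomorphic_map_openness[OF h] tU by blast
  then have "open (\<phi> ` (U \<inter> V))" using o\<phi> openin_open_eq by blast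
  then obtain r where r: "r > 0" "ball (\<phi> x) r \<subseteq> \<phi> ` (U \<inter> V)"
    using U V open_contains_ball by blast
  let ?B = "ball (\<phi> x) r"
  have "openin (top_of_set (\<phi> ` U)) ?B" using r by (auto simp: openin_open_eq o\<phi>)
  then have "openin (subtopology (mtop M) U) (g ` ?B)"
    using homeomorphic_imp_open_map[OF gh] by (simp add: open_map_def)
  then have "openin (mtop M) (g ` ?B)" using oU openin_trans_full by blast
  moreover have "connectedin (mtop M) (g ` ?B)"
  proof -
    have "connectedin (top_of_set (\<phi> ` U)) ?B" using r by (auto simp: connectedin_subtopology)
    then have "connectedin (subtopology (mtop M) U) (g ` ?B)"
      using gc connectedin_continuous_map_image by blast
    then show ?thesis by (simp add: connectedin_subtopology)
  qed
  moreover have "x \<in> g ` ?B" using g\<phi> U r by (metis centre_in_ball image_eqI)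
  moreover have "g ` ?B \<subseteq> V" using r(2) g\<phi> by fastforce
  ultimately show "\<exists>U. openin (mtop M) U \<and> connectedin (mtop M) U \<and> x \<in> U \<and> U \<subseteq> V" by blast
qed

context orbit_projection
begin

text \<open>
  The group permutes the components of the preimage of \<open>V\<close>, which are open, so their images are open
  and pairwise equal or disjoint. As \<open>V\<close> is connected, there is only one image.
\<close>

lemma component_onto:
  assumes lc: "locally_connected_space X" and Y: "quotient_map X Y q"
    and V: "openin Y V" "connectedin Y V"
    and D: "D \<in> connected_components_of (subtopology X {x \<in> topspace X. q x \<in> V})"
  shows "q ` D = V"
proof -
  define S where "S = {x \<in> topspace X. q x \<in> V}"
  have contq: "continuous_map X Y q" using Y quotient_imp_continuous_map by blast
  have oS: "openin X S" unfolding S_def using contq V(1) openin_continuous_map_preimage by blast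
  note comps = locally_connected_space_open_connected_components[THEN iffD1, OF lc, rule_format]
  have oD: "openin X D" using comps oS D by (simp add: S_def)
  have DS: "D \<subseteq> S" using connected_components_of_subset[OF D] by (auto simp: S_def)
  have D0: "D \<noteq> {}" using nonempty_connected_components_of[OF D] .
  define R where "R = (\<Union>h\<in>H. h ` D)"
  have "openin X (h ` D)" if "h \<in> H" for h
    using homeomorphic_imp_open_map[OF homeo[OF that]] oD by (simp add: open_map_def)
  then have oR: "openin X R" unfolding R_def by (intro openin_Union) auto
  have pre: "x \<in> R \<longleftrightarrow> q x \<in> q ` D" if "x \<in> topspace X" for x
  proof
    assume "x \<in> R"
    then obtain h d where "h \<in> H" "d \<in> D" "x = h d" by (auto simp: R_def)
    then have "q x = q d" using proj_inv DS by (auto simp: S_def)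
    then show "q x \<in> q ` D" using \<open>d \<in> D\<close> by blast
  next
    assume "q x \<in> q ` D"
    then obtain d where "d \<in> D" "q d = q x" by auto
    then show "x \<in> R" using fibre_transitive[of d x] that DS by (auto simp: R_def S_def)
  qed
  have oSR: "openin X (S - R)"
  proof (subst openin_subopen, intro ballI)
    fix x assume x: "x \<in> S - R"
    let ?E = "connected_component_of_set (subtopology X S) x"
    have xt: "x \<in> topspace (subtopology X S)" using x by (auto simp: S_def)
    then have E: "?E \<in> connected_components_of (subtopology X S)"
      by (simp add: connected_component_in_connected_components_of)
    have oE: "openin X ?E" using comps oS E by blast
    have xE: "x \<in> ?E" using xt by (simp add: connected_component_of_refl)
    have ES: "?E \<subseteq> S" using connected_components_of_subset[OF E] by auto
    have "?E \<inter> R = {}"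
    proof (rule ccontr)
      assume "?E \<inter> R \<noteq> {}"
      then obtain h e where h: "h \<in> H" "e \<in> D" "h e \<in> ?E" by (auto simp: R_def)
      obtain \<eta> where \<eta>: "homeomorphic_maps X X h \<eta>" "\<And>x. x \<in> topspace X \<Longrightarrow> q (\<eta> x) = q x"
        using inverse_proj[OF h(1)] by metis
      have \<eta>c: "continuous_map X X \<eta>" and \<eta>h: "\<And>y. y \<in> topspace X \<Longrightarrow> h (\<eta> y) = y"
        and h\<eta>: "\<And>y. y \<in> topspace X \<Longrightarrow> \<eta> (h y) = y"
        using \<eta>(1) by (simp_all add: homeomorphic_maps_def)
      have \<eta>X: "\<eta> y \<in> topspace X" if "y \<in> topspace X" for y
        using continuous_map_image_subset_topspace[OF \<eta>c] that by blast
      have "connectedin X ?E"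
        using connectedin_connected_components_of[OF E] unfolding connectedin_subtopology by (rule conjunct1)
      then have "connectedin X (\<eta> ` ?E)" using connectedin_continuous_map_image[OF \<eta>c] by blast
      moreover have "\<eta> y \<in> S" if "y \<in> ?E" for y
      proof -
        have "y \<in> S" using ES that by blast
        then show ?thesis using \<eta>(2)[of y] \<eta>X[of y] by (simp add: S_def)
      qed
      then have "\<eta> ` ?E \<subseteq> S" by blast
      ultimately have "connectedin (subtopology X S) (\<eta> ` ?E)" unfolding connectedin_subtopology by blast
      moreover have "\<eta> (h e) = e" using h\<eta> h(2) DS by (auto simp: S_def)
      then have "\<not> disjnt D (\<eta> ` ?E)" using h(2,3) unfolding disjnt_iff by (metis imageI)
      ultimately have "\<eta> ` ?E \<subseteq> D"
        using connected_components_of_maximal[OF D[folded S_def]] by blast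
      then have "\<eta> x \<in> D" using xE by blast
      then have "h (\<eta> x) \<in> R" using h(1) by (auto simp: R_def)
      then show False using \<eta>h[of x] x by (auto simp: S_def)
    qed
    then show "\<exists>T. openin X T \<and> x \<in> T \<and> T \<subseteq> S - R" using oE xE ES by blast
  qed
  have Ytop: "q ` topspace X = topspace Y" using Y quotient_imp_surjective_map by blast
  have VY: "V \<subseteq> topspace Y" using V(1) openin_subset by blast
  have openY: "openin Y A \<longleftrightarrow> openin X {x \<in> topspace X. q x \<in> A}" if "A \<subseteq> topspace Y" for A
    using Y that by (simp add: quotient_map_def)
  have sub: "q ` D \<subseteq> V" using DS by (auto simp: S_def)
  have RX: "R \<subseteq> topspace X" using oR openin_subset by blast
  have "{x \<in> topspace X. q x \<in> q ` D} = R" using pre RX by blast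
  then have o1: "openin Y (q ` D)" using oR openY sub VY by simp
  have "{x \<in> topspace X. q x \<in> V - q ` D} = S - R" using pre by (auto simp: S_def)
  then have o2: "openin Y (V - q ` D)" using oSR openY[of "V - q ` D"] VY by auto
  have "V - q ` D = {}"
  proof (rule ccontr)
    assume "V - q ` D \<noteq> {}"
    then show False using V(2) o1 o2 D0 sub unfolding connectedin
      by (metis (no_types, lifting) Diff_disjoint Diff_partition Int_absorb1 Int_commute Int_empty_left 
          Un_Diff_cancel image_is_empty inf_le1 order_refl Diff_subset)
  qed
  with sub show ?thesis by blast
qed

end

lemma global_quotient_orbit_projection:
  assumes "is_model (quotient_model M G \<theta>)"
  shows "orbit_projection (mtop M) (\<theta> ` carrier G) (orbit G \<theta>)"
    and "locally_connected_space (mtop M)"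
    and "quotient_map (mtop M) (base (quotient_model M G \<theta>)) (orbit G \<theta>)"
proof -
  have sm: "smooth_manifold M" and d: "\<And>g. g \<in> carrier G \<Longrightarrow> diffeo M M (\<theta> g)"
    and orb: "\<And>x y. x \<in> pts M \<Longrightarrow> y \<in> pts M \<Longrightarrow> orbit G \<theta> x = orbit G \<theta> y \<longleftrightarrow> y \<in> orbit G \<theta> x"
    and qm: "quotient_map (mtop M) (base (quotient_model M G \<theta>)) (orbit G \<theta>)"
    using assms by (auto simp: is_model_def quotient_model_def)
  show "locally_connected_space (mtop M)" using sm smooth_manifold_locally_connected by blast
  show "quotient_map (mtop M) (base (quotient_model M G \<theta>)) (orbit G \<theta>)" by (rule qm)
  show "orbit_projection (mtop M) (\<theta> ` carrier G) (orbit G \<theta>)"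
  proof
    show "Hausdorff_space (mtop M)" using sm by (simp add: smooth_manifold_def)
    show hm: "homeomorphic_map (mtop M) (mtop M) h" if "h \<in> \<theta> ` carrier G" for h
      using that d by (auto simp: diffeo_def)
    show "orbit G \<theta> (h x) = orbit G \<theta> x" if h: "h \<in> \<theta> ` carrier G" and x: "x \<in> pts M" for h x
    proof -
      have "h x \<in> pts M" using hm[OF h] x by (metis homeomorphic_imp_surjective_map imageI)
      moreover have "h x \<in> orbit G \<theta> x" using h by (auto simp: orbit_def)
      ultimately show ?thesis using orb x by metis
    qed
    show "\<exists>h\<in>\<theta> ` carrier G. h x = y" if "x \<in> pts M" "y \<in> pts M" "orbit G \<theta> x = orbit G \<theta> y" for x y
      using orb[OF that(1,2)] that(3) by (auto simp: orbit_def)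
  qed
qed

lemma universal_covering_local_homeo:
  assumes "universal_covering C \<pi> M" "u \<in> pts C"
  obtains S T where "openin (mtop C) S" "u \<in> S" "openin (mtop M) T"
    "homeomorphic_map (subtopology (mtop C) S) (subtopology (mtop M) T) \<pi>"
proof -
  have "\<pi> u \<in> pts M" using assms by (auto simp: universal_covering_def)
  note sheets = assms(1)[unfolded universal_covering_def, THEN conjunct2, THEN conjunct2,
      THEN conjunct2, THEN conjunct2, THEN bspec, OF this]
  obtain T \<V> where T: "\<pi> u \<in> T" "openin (mtop M) T" and V: "\<Union>\<V> = {u \<in> pts C. \<pi> u \<in> T}"
    "\<forall>V\<in>\<V>. openin (mtop C) V" "\<forall>V\<in>\<V>. diffeo (open_sub C V) (open_sub M T) \<pi>"
    using sheets by (elim exE conjE) (rule that; assumption)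
  have "u \<in> \<Union>\<V>" using V(1) T(1) assms(2) by simp
  then obtain W where W: "W \<in> \<V>" "u \<in> W" by blast
  then have "homeomorphic_map (subtopology (mtop C) W) (subtopology (mtop M) T) \<pi>"
    using V(3) by (auto simp: diffeo_def open_sub_def)
  then show thesis using that T(2) V(2) W by blast
qed

lemma homeomorphic_map_open_restrict:
  assumes h: "homeomorphic_map (subtopology X S) (subtopology Y T) h" and S: "openin X S" and T: "openin Y T"
    and A: "openin X A" "A \<subseteq> S"
  shows "openin Y (h ` A)" "homeomorphic_map (subtopology X A) (subtopology Y (h ` A)) h"
proof -
  have hS: "h ` S = T"
    using homeomorphic_imp_surjective_map[OF h] openin_subset[OF S] openin_subset[OF T]
    by (simp add: Int_absorb1)
  have "openin (subtopology X S) A" using A S by (simp add: openin_open_subtopology)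
  then have "openin (subtopology Y T) (h ` A)"
    using homeomorphic_imp_open_map[OF h] by (simp add: open_map_def)
  then show "openin Y (h ` A)" using T openin_trans_full by blast
  have hA: "h ` A \<subseteq> T" using A hS by blast
  have "h ` (topspace (subtopology X S) \<inter> A) = topspace (subtopology Y T) \<inter> h ` A"
    using A hS hA openin_subset[OF S] openin_subset[OF T] by (simp add: topspace_subtopology_subset Int_absorb1)
  from homeomorphic_map_subtopologies[OF h this]
  show "homeomorphic_map (subtopology X A) (subtopology Y (h ` A)) h"
    using A hA by (simp add: subtopology_subtopology Int_absorb1)
qed

text \<open>Coverings are local homeomorphisms, so \<open>F\<close> can be conjugated by the sheets through \<open>u\<close> and \<open>F u\<close>.\<close>

lemma universal_covering_descend:
  assumes C: "universal_covering C \<pi> M" and C': "universal_covering C' \<pi>' M'"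
    and F: "homeomorphic_map (mtop C) (mtop C') F" and u: "u \<in> pts C"
  obtains B g where "openin (mtop M) B" "\<pi> u \<in> B" "openin (mtop M') (g ` B)"
    "homeomorphic_map (subtopology (mtop M) B) (subtopology (mtop M') (g ` B)) g"
    "\<And>b. b \<in> B \<Longrightarrow> \<exists>v\<in>pts C. \<pi> v = b \<and> g b = \<pi>' (F v)"
proof -
  have Fu: "F u \<in> pts C'" using F u by (metis homeomorphic_imp_surjective_map imageI)
  obtain S T where S: "openin (mtop C) S" "u \<in> S" "openin (mtop M) T"
    "homeomorphic_map (subtopology (mtop C) S) (subtopology (mtop M) T) \<pi>"
    using universal_covering_local_homeo[OF C u] by metis
  obtain S' T' where S': "openin (mtop C') S'" "F u \<in> S'" "openin (mtop M') T'"
    "homeomorphic_map (subtopology (mtop C') S') (subtopology (mtop M') T') \<pi>'"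
    using universal_covering_local_homeo[OF C' Fu] by metis
  define S0 where "S0 = {v \<in> pts C. F v \<in> S'} \<inter> S"
  have oS0: "openin (mtop C) S0" unfolding S0_def
    using S(1) S'(1) F homeomorphic_imp_continuous_map openin_continuous_map_preimage by blast
  have S0: "S0 \<subseteq> S" "F ` S0 \<subseteq> S'" "u \<in> S0" using S(2) S'(2) u by (auto simp: S0_def)
  have F': "homeomorphic_map (subtopology (mtop C) (pts C)) (subtopology (mtop C') (pts C')) F" using F by simp
  note b = homeomorphic_map_open_restrict[OF S(4,1,3) oS0 S0(1)]
  note m = homeomorphic_map_open_restrict[OF F' openin_topspace openin_topspace oS0]
  have oF: "openin (mtop C') (F ` S0)" "homeomorphic_map (subtopology (mtop C) S0) (subtopology (mtop C') (F ` S0)) F"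
    using m openin_subset[OF oS0] by auto
  note t = homeomorphic_map_open_restrict[OF S'(4,1,3) oF(1) S0(2)]
  obtain s where s: "homeomorphic_maps (subtopology (mtop C) S0) (subtopology (mtop M) (\<pi> ` S0)) \<pi> s"
    using b(2) homeomorphic_map_maps by blast
  then have sh: "homeomorphic_map (subtopology (mtop M) (\<pi> ` S0)) (subtopology (mtop C) S0) s"
    using homeomorphic_maps_map by (metis homeomorphic_maps_sym)
  have tS0: "topspace (subtopology (mtop C) S0) = S0" using openin_subset[OF oS0] by auto
  have s\<pi>: "s (\<pi> v) = v" if "v \<in> S0" for v using s that tS0 by (simp add: homeomorphic_maps_def)
  have g: "homeomorphic_map (subtopology (mtop M) (\<pi> ` S0)) (subtopology (mtop M') (\<pi>' ` F ` S0)) (\<pi>' \<circ> (F \<circ> s))"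
    using homeomorphic_map_compose[OF homeomorphic_map_compose[OF sh oF(2)] t(2)] .
  have im: "(\<pi>' \<circ> (F \<circ> s)) ` \<pi> ` S0 = \<pi>' ` F ` S0" using s\<pi> by (force simp: image_comp)
  show thesis
  proof (rule that[of "\<pi> ` S0" "\<pi>' \<circ> (F \<circ> s)"])
    show "\<exists>v\<in>pts C. \<pi> v = b \<and> (\<pi>' \<circ> (F \<circ> s)) b = \<pi>' (F v)" if "b \<in> \<pi> ` S0" for b
      using that s\<pi> openin_subset[OF oS0] by auto
  qed (use b t g im S0 in auto)
qed

section \<open>The charts of the kite\<close>

text \<open>Division by \<open>\<phi>\<close> is eliminated, so that all relations become polynomial in \<open>\<phi>\<close>.\<close>

lemma divide_golden: "x / golden = x * (golden - 1)" for x :: real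
  using arg_cong[OF inverse_golden, of "(*) x"] by simp

lemma kite_level_iff:
  "z \<in> kite_level \<longleftrightarrow>
     (cmod (z $ 1))\<^sup>2 + (golden - 1) * (cmod (z $ 2))\<^sup>2 + (cmod (z $ 3))\<^sup>2 = golden * kite_sigma \<and>
     (cmod (z $ 4))\<^sup>2 + (golden - 1) * (cmod (z $ 2))\<^sup>2 = (golden - 1) * (cmod (z $ 1))\<^sup>2 + (golden - 1) * kite_sigma"
  unfolding kite_level_def kite_Psi_def inverse_golden divide_golden
  by (auto simp: algebra_simps)

lemma kite_corner_12: "kite_corner 1 2 3 4
    (\<lambda>w. golden * kite_sigma - (cmod (fst w))\<^sup>2 - (golden - 1) * (cmod (snd w))\<^sup>2)
    (\<lambda>w. (golden - 1) * (kite_sigma + (cmod (fst w))\<^sup>2 - (cmod (snd w))\<^sup>2))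
    (golden - 1) (golden - 1) 1 0"
proof
  show "wind s t $ 3 = x \<and> wind s t $ 4 = y \<longleftrightarrow> s = (golden - 1) * x + (golden - 1) * y \<and> t = 1 * x + 0 * y"
    for s t x y using golden_square by (simp, algebra)
qed (auto intro!: continuous_intros simp: kite_level_iff algebra_simps)

lemma kite_corner_34: "kite_corner 3 4 1 2
    (\<lambda>w. (golden - 1) * (kite_sigma - (cmod (fst w))\<^sup>2 + (cmod (snd w))\<^sup>2))
    (\<lambda>w. golden * kite_sigma - (golden - 1) * (cmod (fst w))\<^sup>2 - (cmod (snd w))\<^sup>2)
    0 1 (golden - 1) (golden - 1)"
proof
  show "wind s t $ 1 = x \<and> wind s t $ 2 = y \<longleftrightarrow> s = 0 * x + 1 * y \<and> t = (golden - 1) * x + (golden - 1) * y"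
    for s t x y using golden_square by (simp, algebra)
  show "z \<in> kite_level \<longleftrightarrow>
    (cmod (z $ 1))\<^sup>2 = (golden - 1) * (kite_sigma - (cmod (fst (z $ 3, z $ 4)))\<^sup>2 + (cmod (snd (z $ 3, z $ 4)))\<^sup>2) \<and>
    (cmod (z $ 2))\<^sup>2 = golden * kite_sigma - (golden - 1) * (cmod (fst (z $ 3, z $ 4)))\<^sup>2 - (cmod (snd (z $ 3, z $ 4)))\<^sup>2"
    for z unfolding kite_level_iff fst_conv snd_conv using golden_square by algebra
qed (auto intro!: continuous_intros)

lemma kite_corner_14: "kite_corner 1 4 2 3
    (\<lambda>w. kite_sigma + (cmod (fst w))\<^sup>2 - golden * (cmod (snd w))\<^sup>2)
    (\<lambda>w. kite_sigma - golden * (cmod (fst w))\<^sup>2 + (cmod (snd w))\<^sup>2)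
    1 0 0 1"
proof
  show "z \<in> kite_level \<longleftrightarrow>
    (cmod (z $ 2))\<^sup>2 = kite_sigma + (cmod (fst (z $ 1, z $ 4)))\<^sup>2 - golden * (cmod (snd (z $ 1, z $ 4)))\<^sup>2 \<and>
    (cmod (z $ 3))\<^sup>2 = kite_sigma - golden * (cmod (fst (z $ 1, z $ 4)))\<^sup>2 + (cmod (snd (z $ 1, z $ 4)))\<^sup>2"
    for z unfolding kite_level_iff fst_conv snd_conv using golden_square by algebra
qed (auto intro!: continuous_intros)

lemma kite_corner_23: "kite_corner 2 3 1 4
    (\<lambda>w. golden * kite_sigma - (golden - 1) * (cmod (fst w))\<^sup>2 - (cmod (snd w))\<^sup>2)
    (\<lambda>w. golden * kite_sigma - (cmod (fst w))\<^sup>2 - (golden - 1) * (cmod (snd w))\<^sup>2)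
    (golden - 1) 1 1 (golden - 1)"
proof
  show "wind s t $ 1 = x \<and> wind s t $ 4 = y \<longleftrightarrow> s = (golden - 1) * x + 1 * y \<and> t = 1 * x + (golden - 1) * y"
    for s t x y using golden_square by (simp, algebra)
  show "z \<in> kite_level \<longleftrightarrow>
    (cmod (z $ 1))\<^sup>2 = golden * kite_sigma - (golden - 1) * (cmod (fst (z $ 2, z $ 3)))\<^sup>2 - (cmod (snd (z $ 2, z $ 3)))\<^sup>2 \<and>
    (cmod (z $ 4))\<^sup>2 = golden * kite_sigma - (cmod (fst (z $ 2, z $ 3)))\<^sup>2 - (golden - 1) * (cmod (snd (z $ 2, z $ 3)))\<^sup>2"
    for z unfolding kite_level_iff fst_conv snd_conv using golden_square by algebra
qed (auto intro!: continuous_intros)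

lemma kite_chart_corner:
  assumes "\<alpha> \<in> qatlas kite_quasifold"
  obtains i j k l P Q a b c d where "kite_corner i j k l P Q a b c d" "\<alpha> = kite_chart i j k l"
  using assms kite_corner_12 kite_corner_34 kite_corner_14 kite_corner_23
  unfolding kite_quasifold_def by auto

context kite_corner
begin

lemma kite_chart_param:
  assumes w: "w \<in> kite_U i j k l"
  shows "param (kite_chart i j k l) (orbit (kite_Gamma k l) (kite_Gamma_act i j k l) w) = kite_class (sec w)"
proof -
  let ?O = "orbit (kite_Gamma k l) (kite_Gamma_act i j k l) w"
  have "kite_class (kite_lift i j k l v) = kite_class (sec w)" if v: "v \<in> ?O" for v
  proof -
    obtain u where u: "u \<in> kite_N" "u $ k = 1" "u $ l = 1" "v = (u $ i * fst w, u $ j * snd w)"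
      using v w by (auto simp: orbit_def kite_Gamma_def kite_Gamma_act_def)
    then obtain s t where st: "u = torus_exp (wind s t)" by (auto simp: kite_N_wind)
    have "\<exists>r>0. torus_act u (sec w) $ k = of_real r" "\<exists>r>0. torus_act u (sec w) $ l = of_real r"
      using w u by (auto simp: U_eq intro: real_sqrt_gt_zero)
    then have "kite_lift_of i j k l v (torus_act u (sec w))"
      using sec_level[OF w] u by (simp add: kite_lift_of_def st kite_level_torus)
    then have "v \<in> kite_U i j k l" "sec v = torus_act u (sec w)" by (auto simp: kite_lift_of_iff kite_U_def)
    then show ?thesis by (simp add: kite_lift_eq st kite_class_wind)
  qed
  moreover have "w \<in> ?O"
  proof -
    have "torus_exp 0 \<in> kite_N" using wind_0 unfolding kite_N_wind by (metis (mono_tags, lifting) mem_Collect_eq)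
    then have "torus_exp 0 \<in> carrier (kite_Gamma k l)" by (simp add: kite_Gamma_def)
    moreover have "kite_Gamma_act i j k l (torus_exp 0) w = w" using w by (simp add: kite_Gamma_act_def)
    ultimately show ?thesis unfolding orbit_def by (metis (mono_tags, lifting) mem_Collect_eq)
  qed
  ultimately have "(\<lambda>v. kite_class (kite_lift i j k l v)) ` ?O = {kite_class (sec w)}" by blast
  then show ?thesis by (simp add: kite_chart_def)
qed

end

lemma topspace_quotient_topology: "topspace (quotient_topology X p) = p ` topspace X"
proof
  show "topspace (quotient_topology X p) \<subseteq> p ` topspace X"
    using openin_topspace[of "quotient_topology X p"] unfolding openin_quotient_topology by blast
  have "{x \<in> topspace X. p x \<in> p ` topspace X} = topspace X" by blast
  then have "openin (quotient_topology X p) (p ` topspace X)" by (simp add: openin_quotient_topology)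
  then show "p ` topspace X \<subseteq> topspace (quotient_topology X p)" by (rule openin_subset)
qed

lemma kite_qtop_topspace: "topspace (qtop kite_quasifold) = kite_class ` kite_level"
  by (simp add: kite_quasifold_def topspace_quotient_topology)

lemma kite_qtop_openin: "openin (qtop kite_quasifold) W \<Longrightarrow>
    openin (top_of_set kite_level) {z \<in> kite_level. kite_class z \<in> W}"
  by (simp add: kite_quasifold_def openin_quotient_topology)

lemma (in kite_corner) open_preimage:
  assumes "openin (qtop kite_quasifold) W"
  shows "open {w \<in> kite_U i j k l. kite_class (sec w) \<in> W}"
proof -
  obtain R where R: "open R" "{z \<in> kite_level. kite_class z \<in> W} = kite_level \<inter> R"
    using kite_qtop_openin[OF assms] by (auto simp: openin_open)
  have "{w \<in> kite_U i j k l. kite_class (sec w) \<in> W} = kite_U i j k l \<inter> sec -` R"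
    using R(2) sec_level by blast
  then show ?thesis
    using continuous_open_preimage[OF continuous_sec open_U R(1)] by simp
qed

text \<open>
  A quasifold diffeomorphism onto a global quotient lifts near every point to a homeomorphism from an
  open set in a chart of the kite onto an open subset of the manifold. Which chart this is cannot be
  prescribed. The diffeomorphism \<open>F\<close> of universal covering models descends to the local lift.
  That the point is reached at all is seen on the side of the manifold: the component \<open>D\<close> of
  the preimage of \<open>V\<close> maps onto \<open>V\<close>.
\<close>

lemma chart_local_homeo:
  fixes M :: "('a, 'e::real_normed_vector) mfd"
  assumes model: "is_model (quotient_model M G \<theta>)"
    and f: "quasifold_diffeo kite_quasifold (global_quotient M G \<theta>) f"
    and z: "z \<in> kite_level"
  obtains i j k l P Q a b c d B g w where "kite_corner i j k l P Q a b c d"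
    "open B" "B \<subseteq> kite_U i j k l" "w \<in> B" "kite_class (kite_corner.sec i j k P Q w) = kite_class z"
    "openin (mtop M) (g ` B)" "homeomorphic_map (top_of_set B) (subtopology (mtop M) (g ` B)) g"
    "\<And>b. b \<in> B \<Longrightarrow> orbit G \<theta> (g b) = f (kite_class (kite_corner.sec i j k P Q b))"
proof -
  let ?M = "qtop kite_quasifold" and ?Y = "base (quotient_model M G \<theta>)" and ?q = "orbit G \<theta>"
  interpret orbit_projection "mtop M" "\<theta> ` carrier G" ?q
    by (rule global_quotient_orbit_projection[OF model])
  note lc = global_quotient_orbit_projection(2)[OF model]
  note qm = global_quotient_orbit_projection(3)[OF model]
  have Y: "qtop (global_quotient M G \<theta>) = ?Y" by (simp add: global_quotient_def)
  have fh: "homeomorphic_map ?M ?Y f" and loc: "locally_model_diffeo kite_quasifold (global_quotient M G \<theta>) f"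
    using f Y by (simp_all add: quasifold_diffeo_def)
  let ?x = "kite_class z"
  have xM: "?x \<in> topspace ?M" using z by (simp add: kite_qtop_topspace)
  obtain \<alpha> \<beta> V where \<alpha>: "\<alpha> \<in> qatlas kite_quasifold" and \<beta>: "\<beta> \<in> qatlas (global_quotient M G \<theta>)"
    and V: "f ?x \<in> V" "openin ?Y V" "connectedin ?Y V"
    and icd: "induced_cover_diffeo (qmodel \<alpha>) (param_preimage \<alpha> {y \<in> topspace ?M. f y \<in> V})
      (qmodel \<beta>) (param_preimage \<beta> V) (param_inv \<beta> \<circ> f \<circ> param \<alpha>)"
    using bspec[OF loc[unfolded locally_model_diffeo_def] xM] unfolding Y
    by (elim bexE exE conjE) (rule that; assumption)
  obtain i j k l P Q a b c d where corner: "kite_corner i j k l P Q a b c d" and \<alpha>eq: "\<alpha> = kite_chart i j k l"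
    using kite_chart_corner[OF \<alpha>] by metis
  interpret c: kite_corner i j k l P Q a b c d by (rule corner)
  have \<beta>eq: "domain \<beta> = topspace ?Y" "param \<beta> = (\<lambda>x. x)" "qmodel \<beta> = quotient_model M G \<theta>"
    using \<beta> by (simp_all add: global_quotient_def)
  have VY: "V \<subseteq> topspace ?Y" using V(2) openin_subset by blast
  have pre\<beta>: "param_preimage \<beta> V = V" using VY by (auto simp: param_preimage_def \<beta>eq)
  have inv\<beta>: "param_inv \<beta> y = y" if "y \<in> V" for y
    using inv_into_f_f[of "\<lambda>x. x" "topspace ?Y" y] that VY by (auto simp: param_inv_def \<beta>eq)
  define W where "W = {y \<in> topspace ?M. f y \<in> V}"
  have oW: "openin ?M W" unfolding W_def
    using fh V(2) homeomorphic_imp_continuous_map openin_continuous_map_preimage by blast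
  let ?W = "param_preimage \<alpha> W"
  obtain m' n' m'' n'' where m': "m' \<in> induced_models (qmodel \<alpha>) ?W"
    and n': "n' \<in> induced_models (quotient_model M G \<theta>) V"
    and m'': "m'' \<in> universal_covering_models m'" and n'': "n'' \<in> universal_covering_models n'"
    and md: "model_diffeo m'' n'' (param_inv \<beta> \<circ> f \<circ> param \<alpha>)"
    using icd unfolding induced_cover_diffeo_def pre\<beta> \<beta>eq W_def[symmetric] by blast
  let ?p = "orbit (kite_Gamma k l) (kite_Gamma_act i j k l)"
  let ?U = "kite_U i j k l"
  have q\<alpha>: "qmodel \<alpha> = quotient_model (kite_U_mfd i j k l) (kite_Gamma k l) (kite_Gamma_act i j k l)"
    by (simp add: \<alpha>eq kite_chart_def)
  define CS where "CS = {w \<in> ?U. ?p w \<in> ?W}"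
  obtain C where C: "C \<in> connected_components_of (subtopology (top_of_set ?U) CS)"
    and m'eq: "m' = restricted_model (qmodel \<alpha>) ?W C"
    using m' unfolding induced_models_def q\<alpha> by (auto simp: quotient_model_def kite_U_mfd_def CS_def)
  define DS where "DS = {x \<in> pts M. ?q x \<in> V}"
  obtain D where D: "D \<in> connected_components_of (subtopology (mtop M) DS)"
    and n'eq: "n' = restricted_model (quotient_model M G \<theta>) V D"
    using n' unfolding induced_models_def by (auto simp: quotient_model_def DS_def)
  obtain Cs \<pi> where Cs: "universal_covering Cs \<pi> (cover m')" and m''eq: "m'' = covering_model Cs \<pi> m'"
    using m'' by (auto simp: universal_covering_models_def)
  obtain Ds \<pi>' where Ds: "universal_covering Ds \<pi>' (cover n')" and n''eq: "n'' = covering_model Ds \<pi>' n'"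
    using n'' by (auto simp: universal_covering_models_def)
  obtain F where F: "homeomorphic_map (mtop Cs) (mtop Ds) F"
    and Fp: "\<And>u. u \<in> pts Cs \<Longrightarrow> proj n'' (F u) = (param_inv \<beta> \<circ> f \<circ> param \<alpha>) (proj m'' u)"
    using md unfolding model_diffeo_def by (auto simp: m''eq n''eq covering_model_def diffeo_def)
  have CSsub: "CS \<subseteq> ?U" "DS \<subseteq> pts M" by (auto simp: CS_def DS_def)
  have CC: "C \<subseteq> CS" using connected_components_of_subset[OF C] by auto
  have DD: "D \<subseteq> DS" using connected_components_of_subset[OF D] by auto
  have inW: "kite_class (c.sec w) \<in> W" if "w \<in> CS" for w
    using that c.kite_chart_param[of w] by (auto simp: CS_def param_preimage_def \<alpha>eq)
  have CSeq: "CS = {w \<in> ?U. kite_class (c.sec w) \<in> W}"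
  proof
    show "{w \<in> ?U. kite_class (c.sec w) \<in> W} \<subseteq> CS"
    proof clarify
      fix w1 w2 assume w: "(w1, w2) \<in> ?U" "kite_class (c.sec (w1, w2)) \<in> W"
      have "?p (w1, w2) \<in> model_pts \<alpha>"
        using w by (simp add: q\<alpha> quotient_model_def topspace_quotient_topology kite_U_mfd_def)
      then show "(w1, w2) \<in> CS"
        using w c.kite_chart_param[of "(w1, w2)"] by (auto simp: CS_def param_preimage_def \<alpha>eq)
    qed
  qed (use inW in \<open>auto simp: CS_def\<close>)
  have oCS: "open CS" unfolding CSeq by (rule c.open_preimage[OF oW])
  have oDS: "openin (mtop M) DS" unfolding DS_def
    using quotient_imp_continuous_map[OF qm] V(2) openin_continuous_map_preimage by blast
  have oC: "open C"
  proof -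
    have "locally_connected_space (euclidean :: (complex \<times> complex) topology)"
      unfolding locally_connected_space
    proof (intro allI impI)
      fix R :: "(complex \<times> complex) set" and x assume "openin euclidean R \<and> x \<in> R"
      then obtain r where "r > 0" "ball x r \<subseteq> R" by (auto simp: open_contains_ball)
      then show "\<exists>B. openin euclidean B \<and> connectedin euclidean B \<and> x \<in> B \<and> B \<subseteq> R"
        by (intro exI[of _ "ball x r"]) (auto simp: connectedin_iff_connected)
    qed
    moreover have "C \<in> connected_components_of (top_of_set CS)"
      using C CSsub by (simp add: subtopology_subtopology Int_absorb1)
    ultimately have "openin euclidean C"
      using locally_connected_space_open_connected_components oCS by (metis open_openin)
    then show ?thesis by simp
  qed
  have oD: "openin (mtop M) D"
    using locally_connected_space_open_connected_components lc oDS D by blast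
  have qD: "?q ` D = V"
    using component_onto[OF lc qm V(2,3)] D by (simp add: DS_def)
  have cover': "mtop (cover m') = top_of_set C" "mtop (cover n') = subtopology (mtop M) D"
    using CC CSsub by (auto simp: m'eq n'eq restricted_model_def open_sub_def q\<alpha> quotient_model_def
        kite_U_mfd_def subtopology_subtopology Int_absorb1)
  have \<pi>C: "\<pi> u \<in> C" if "u \<in> pts Cs" for u
    using Cs that cover' by (auto simp: universal_covering_def)
  have \<pi>D: "\<pi>' ` pts Ds = D"
    using Ds cover' openin_subset[OF oD] by (auto simp: universal_covering_def)
  have key: "?q (\<pi>' (F u)) = f (kite_class (c.sec (\<pi> u)))" if u: "u \<in> pts Cs" for u
  proof -
    have "F u \<in> pts Ds" using F u by (metis homeomorphic_imp_surjective_map imageI)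
    then have "\<pi>' (F u) \<in> D" using \<pi>D by blast
    then have "proj n'' (F u) = ?q (\<pi>' (F u))"
      by (simp add: n''eq n'eq covering_model_def restricted_model_def quotient_model_def)
    moreover have "proj m'' u = ?p (\<pi> u)"
      using \<pi>C[OF u] by (simp add: m''eq m'eq covering_model_def restricted_model_def q\<alpha> quotient_model_def)
    moreover have "\<pi> u \<in> ?U" "kite_class (c.sec (\<pi> u)) \<in> W" using \<pi>C[OF u] CC CSsub inW by blast+
    ultimately show ?thesis
      using Fp[OF u] c.kite_chart_param[of "\<pi> u"] inv\<beta> by (simp add: \<alpha>eq W_def)
  qed
  have "f ?x \<in> ?q ` D" using V(1) qD by simp
  then obtain d where d: "d \<in> D" "?q d = f ?x" by auto
  then obtain e where e: "e \<in> pts Ds" "\<pi>' e = d" using \<pi>D by blast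
  then obtain u where u: "u \<in> pts Cs" "F u = e"
    using homeomorphic_imp_surjective_map[OF F] by (metis imageE)
  obtain B g where B: "openin (mtop (cover m')) B" "\<pi> u \<in> B" "openin (mtop (cover n')) (g ` B)"
    "homeomorphic_map (subtopology (mtop (cover m')) B) (subtopology (mtop (cover n')) (g ` B)) g"
    "\<And>b. b \<in> B \<Longrightarrow> \<exists>v\<in>pts Cs. \<pi> v = b \<and> g b = \<pi>' (F v)"
    using universal_covering_descend[OF Cs Ds F u(1)] by metis
  have BC: "B \<subseteq> C" using openin_subset[OF B(1)] cover' by simp
  have gD: "g ` B \<subseteq> D" using openin_subset[OF B(3)] cover' by auto
  show thesis
  proof (rule that[OF corner, of B "\<pi> u" g])
    show "open B" using B(1) oC cover' openin_open_eq by metis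
    show "B \<subseteq> ?U" using BC CC CSsub by blast
    show "openin (mtop M) (g ` B)" using B(3) oD cover' openin_trans_full by metis
    show "homeomorphic_map (top_of_set B) (subtopology (mtop M) (g ` B)) g"
      using B(4) BC gD by (simp add: cover' subtopology_subtopology Int_absorb1)
    have "kite_class (c.sec (\<pi> u)) \<in> W" using \<pi>C[OF u(1)] CC inW by blast
    then have "kite_class (c.sec (\<pi> u)) \<in> topspace ?M" by (simp add: W_def)
    moreover have "f (kite_class (c.sec (\<pi> u))) = f ?x" using key[OF u(1)] u(2) e(2) d(2) by simp
    ultimately show "kite_class (c.sec (\<pi> u)) = ?x"
      using homeomorphic_imp_injective_map[OF fh] xM by (meson inj_onD)
    show "?q (g b) = f (kite_class (c.sec b))" if "b \<in> B" for b
      using B(5)[OF that] key by metis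
  qed (rule B(2))
qed

section \<open>Lifts over polydiscs\<close>

text \<open>
  The radius is chosen such that the charts at the corners \<open>1, 2\<close> and \<open>3, 4\<close> both contain the
  polydisc, and that the two polydiscs still overlap in the quasifold.
\<close>

definition polydisc :: "(complex \<times> complex) set" where
  "polydisc = ball 0 (sqrt kite_sigma) \<times> ball 0 (sqrt kite_sigma)"

lemma polydisc_iff: "w \<in> polydisc \<longleftrightarrow> (cmod (fst w))\<^sup>2 < kite_sigma \<and> (cmod (snd w))\<^sup>2 < kite_sigma"
proof -
  have "cmod x < sqrt kite_sigma \<longleftrightarrow> (cmod x)\<^sup>2 < kite_sigma" for x
    using real_sqrt_less_iff[of "(cmod x)\<^sup>2" kite_sigma] by simp
  then show ?thesis by (cases w) (simp add: polydisc_def)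
qed

lemma open_polydisc: "open polydisc" and convex_polydisc: "convex polydisc"
  by (simp_all add: polydisc_def open_Times convex_Times)

locale kite_global_quotient =
  fixes M :: "('a, 'e::real_normed_vector) mfd" and G :: "'g monoid" and \<theta> :: "'g \<Rightarrow> 'a \<Rightarrow> 'a"
    and f :: "(complex ^ 4) set \<Rightarrow> 'a set"
  assumes model: "is_model (quotient_model M G \<theta>)"
    and diffeo: "quasifold_diffeo kite_quasifold (global_quotient M G \<theta>) f"
begin

sublocale orbit_projection "mtop M" "\<theta> ` carrier G" "orbit G \<theta>"
  by (rule global_quotient_orbit_projection[OF model])

lemma class_eqI:
  assumes "z \<in> kite_level" "z' \<in> kite_level" "f (kite_class z) = f (kite_class z')"
  shows "kite_class z = kite_class z'"
proof -
  have "homeomorphic_map (qtop kite_quasifold) (qtop (global_quotient M G \<theta>)) f"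
    using diffeo by (simp add: quasifold_diffeo_def)
  then have "inj_on f (kite_class ` kite_level)"
    using homeomorphic_imp_injective_map kite_qtop_topspace by metis
  then show ?thesis using assms by (meson image_eqI inj_onD)
qed

text \<open>
  A local homeomorphism \<open>g\<close> on some chart is transported to the given chart by the slice map \<open>T\<close>. It is
  rigid: another lift \<open>h\<close> passes through the open image of \<open>g\<close>, so \<open>g\<close> can be inverted along it.
  The resulting point \<open>\<xi>\<close> of the chart and the point \<open>\<tau>\<close> obtained from the slice map have the
  same class, so they differ by an element of a countable group.
\<close>

lemma chart_rigid_lift:
  assumes corner: "kite_corner i j k l P Q a b c d" and w: "w \<in> kite_U i j k l"
  obtains A L where "open A" "w \<in> A" "rigid_lift (\<lambda>w. f (kite_class (kite_corner.sec i j k P Q w))) A L"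
proof -
  interpret C: kite_corner i j k l P Q a b c d by (rule corner)
  obtain i' j' k' l' P' Q' a' b' c' d' B g v where corner': "kite_corner i' j' k' l' P' Q' a' b' c' d'"
    and B: "open B" "B \<subseteq> kite_U i' j' k' l'" "v \<in> B"
    and v: "kite_class (kite_corner.sec i' j' k' P' Q' v) = kite_class (C.sec w)"
    and g: "openin (mtop M) (g ` B)" "homeomorphic_map (top_of_set B) (subtopology (mtop M) (g ` B)) g"
    and gB: "\<And>b. b \<in> B \<Longrightarrow> orbit G \<theta> (g b) = f (kite_class (kite_corner.sec i' j' k' P' Q' b))"
    using chart_local_homeo[OF model diffeo C.sec_level[OF w]] by metis
  interpret C': kite_corner i' j' k' l' P' Q' a' b' c' d' by (rule corner')
  have vU: "v \<in> kite_U i' j' k' l'" using B by blast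
  obtain S T where S: "open S" "C.sec w \<in> S" "continuous_on S T" "T (C.sec w) = v"
    and T: "\<And>y. y \<in> S \<inter> kite_level \<Longrightarrow> T y \<in> kite_U i' j' k' l' \<and> kite_class (C'.sec (T y)) = kite_class y"
    and Toff: "\<And>y. (\<forall>m. y $ m \<noteq> 0) \<Longrightarrow> T y \<in> off_axes"
    using C'.slice[OF vU C.sec_level[OF w] v] by metis
  define A0 where "A0 = kite_U i j k l \<inter> C.sec -` S"
  have "open A0" unfolding A0_def by (rule continuous_open_preimage[OF C.continuous_sec C.open_U S(1)])
  have contT: "continuous_on A0 (T \<circ> C.sec)"
    by (rule continuous_on_compose[OF C.continuous_sec], rule continuous_on_subset[OF S(3)])
       (auto simp: A0_def)
  define A where "A = A0 \<inter> (T \<circ> C.sec) -` B"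
  have A: "open A" "w \<in> A" unfolding A_def
    using continuous_open_preimage[OF contT \<open>open A0\<close> B(1)] w S B(3) by (auto simp: A0_def)
  have AU: "C.sec u \<in> S \<inter> kite_level" "T (C.sec u) \<in> B" if "u \<in> A" for u
    using that C.sec_level by (auto simp: A_def A0_def)
  have contTA: "continuous_on A (T \<circ> C.sec)" using contT continuous_on_subset A_def by blast
  define L where "L = g \<circ> (T \<circ> C.sec)"
  have contg: "continuous_map (top_of_set B) (mtop M) g"
    using g(2) homeomorphic_imp_continuous_map continuous_map_into_fulltopology by blast
  obtain \<gamma> where \<gamma>: "homeomorphic_maps (top_of_set B) (subtopology (mtop M) (g ` B)) g \<gamma>"
    using g(2) homeomorphic_map_maps by blast
  then have \<gamma>c: "continuous_map (subtopology (mtop M) (g ` B)) (top_of_set B) \<gamma>"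
    and \<gamma>g: "\<And>b. b \<in> B \<Longrightarrow> \<gamma> (g b) = b"
    by (simp_all add: homeomorphic_maps_def)
  have "rigid_lift (\<lambda>w. f (kite_class (C.sec w))) A L"
  proof (rule rigid_liftI)
    have "continuous_map (top_of_set A) (top_of_set B) (T \<circ> C.sec)"
      using contTA AU(2) by (auto simp: continuous_map_in_subtopology continuous_map_iff_continuous)
    then show "continuous_map (top_of_set A) (mtop M) L"
      unfolding L_def using contg continuous_map_compose by blast
    show "orbit G \<theta> (L u) = f (kite_class (C.sec u))" if "u \<in> A" for u
      using gB[OF AU(2)[OF that]] T[OF AU(1)[OF that]] by (simp add: L_def)
  next
    fix K :: "complex set" and k0 h x0
    assume K: "open K" "x0 \<in> K" and k0: "continuous_on K k0" "k0 ` K \<subseteq> A \<inter> off_axes"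
      and h: "continuous_map (top_of_set K) (mtop M) h"
      and qh: "\<And>x. x \<in> K \<Longrightarrow> orbit G \<theta> (h x) = f (kite_class (C.sec (k0 x)))" and x0: "h x0 = L (k0 x0)"
    define \<tau> where "\<tau> = (\<lambda>x. T (C.sec (k0 x)))"
    have k0A: "k0 x \<in> A" if "x \<in> K" for x using k0(2) that by blast
    have \<tau>c: "continuous_on K \<tau>"
    proof -
      have "continuous_on (k0 ` K) (T \<circ> C.sec)" using contTA k0(2) continuous_on_subset by blast
      then have "continuous_on K ((T \<circ> C.sec) \<circ> k0)" using k0(1) continuous_on_compose by blast
      then show ?thesis by (simp add: \<tau>_def comp_def)
    qed
    have \<tau>B: "\<tau> x \<in> B" if "x \<in> K" for x using AU(2) k0A that by (simp add: \<tau>_def)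
    have \<tau>off: "\<tau> x \<in> off_axes" if "x \<in> K" for x
    proof -
      have "k0 x \<in> kite_U i j k l" "k0 x \<in> off_axes" using k0(2) that by (auto simp: A_def A0_def)
      then have "C.sec (k0 x) $ m \<noteq> 0" for m
        using C.indices[of m] by (elim disjE) (simp_all add: C.U_eq off_axes_def)
      then show ?thesis using Toff by (simp add: \<tau>_def)
    qed
    define K1 where "K1 = {x \<in> K. h x \<in> g ` B}"
    have "openin (top_of_set K) K1"
      using openin_continuous_map_preimage[OF h g(1)] by (simp add: K1_def)
    then have "open K1" using K(1) openin_open_eq by blast
    have "x0 \<in> K1" using K(2) x0 \<tau>B[OF K(2)] by (simp add: K1_def L_def \<tau>_def)
    then obtain r where r: "r > 0" "ball x0 r \<subseteq> K1" using \<open>open K1\<close> open_contains_ball by blast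
    let ?K = "ball x0 r"
    have KK: "?K \<subseteq> K" using r(2) by (auto simp: K1_def)
    define \<xi> where "\<xi> = (\<lambda>x. \<gamma> (h x))"
    have hB: "h x \<in> g ` B" if "x \<in> ?K" for x using r(2) that by (auto simp: K1_def)
    have \<xi>c: "continuous_on ?K \<xi>"
    proof -
      have "continuous_map (top_of_set ?K) (subtopology (mtop M) (g ` B)) h"
        using h KK hB by (auto simp: continuous_map_in_subtopology intro: continuous_map_from_subtopology_mono)
      then have "continuous_map (top_of_set ?K) (top_of_set B) (\<gamma> \<circ> h)"
        using \<gamma>c continuous_map_compose by blast
      then show ?thesis by (simp add: \<xi>_def comp_def continuous_map_in_subtopology)
    qed
    have \<xi>: "\<xi> x \<in> B" "g (\<xi> x) = h x" if "x \<in> ?K" for x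
      using hB[OF that] \<gamma>g by (auto simp: \<xi>_def)
    \<comment> \<open>The two lifts differ by elements of the group of the chart, which are recovered as quotients.\<close>
    define \<rho> where "\<rho> = (\<lambda>x. (fst (\<xi> x) / fst (\<tau> x), snd (\<xi> x) / snd (\<tau> x)))"
    have \<rho>c: "continuous_on ?K \<rho>"
      unfolding \<rho>_def using \<xi>c continuous_on_subset[OF \<tau>c KK] \<tau>off KK
      by (intro continuous_intros) (auto simp: off_axes_def)
    have ratio: "\<rho> x \<in> (\<lambda>u. (u $ i', u $ j')) ` {u \<in> kite_N. u $ k' = 1 \<and> u $ l' = 1}" if x: "x \<in> ?K" for x
    proof -
      have xK: "x \<in> K" using KK x by blast
      have U: "\<tau> x \<in> kite_U i' j' k' l'" "\<xi> x \<in> kite_U i' j' k' l'" using \<tau>B[OF xK] \<xi>(1)[OF x] B(2) by auto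
      have "f (kite_class (C'.sec (\<tau> x))) = f (kite_class (C.sec (k0 x)))"
        using T[OF AU(1)[OF k0A[OF xK]]] by (simp add: \<tau>_def)
      also have "\<dots> = f (kite_class (C'.sec (\<xi> x)))" using qh[OF xK] gB[OF \<xi>(1)[OF x]] \<xi>(2)[OF x] by simp
      finally have "kite_class (C'.sec (\<tau> x)) = kite_class (C'.sec (\<xi> x))"
        using class_eqI[OF C'.sec_level[OF U(1)] C'.sec_level[OF U(2)]] by blast
      then obtain u where u: "u \<in> kite_N" "u $ k' = 1" "u $ l' = 1" "\<xi> x = (u $ i' * fst (\<tau> x), u $ j' * snd (\<tau> x))"
        using C'.same_class[OF U] by metis
      then have "\<rho> x = (u $ i', u $ j')" using \<tau>off[OF xK] by (simp add: \<rho>_def off_axes_def)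
      then show ?thesis using u by blast
    qed
    have "countable (\<rho> ` ?K)"
      by (rule countable_subset[OF _ countable_image[OF C'.countable_Gamma]]) (use ratio in blast)
    note const = continuous_countable_range_const[OF connected_ball \<rho>c this]
    have x0K: "x0 \<in> ?K" using r(1) by simp
    have "\<xi> x0 = \<tau> x0" using x0 \<gamma>g \<tau>B[OF K(2)] by (simp add: \<xi>_def \<tau>_def L_def)
    then have "\<rho> x0 = (1, 1)" using \<tau>off[OF K(2)] by (simp add: \<rho>_def off_axes_def)
    have "h x = L (k0 x)" if x: "x \<in> ?K" for x
    proof -
      have "\<rho> x = (1, 1)" using const[OF x x0K] \<open>\<rho> x0 = (1, 1)\<close> by simp
      then have "\<xi> x = \<tau> x" using \<tau>off KK x by (force simp: \<rho>_def off_axes_def prod_eq_iff)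
      then show ?thesis using \<xi>(2)[OF x] by (simp add: L_def \<tau>_def)
    qed
    then show "\<exists>K'. open K' \<and> x0 \<in> K' \<and> K' \<subseteq> K \<and> (\<forall>x\<in>K'. h x = L (k0 x))"
      using x0K KK by (intro exI[of _ ?K]) auto
  qed
  with A show thesis by (rule that)
qed

lemma polydisc_rigid_lift:
  assumes corner: "kite_corner i j k l P Q a b c d" and U: "polydisc \<subseteq> kite_U i j k l"
  obtains L where "rigid_lift (\<lambda>w. f (kite_class (kite_corner.sec i j k P Q w))) polydisc L"
proof -
  have "(0, 0) \<in> polydisc" using kite_sigma_pos by (simp add: polydisc_iff)
  then obtain w0 where w0: "w0 \<in> polydisc" "w0 \<in> off_axes"
    using open_meets_off_axes[OF open_polydisc] by metis
  have "\<exists>A L. open A \<and> w \<in> A \<and> rigid_lift (\<lambda>w. f (kite_class (kite_corner.sec i j k P Q w))) A L"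
    if "w \<in> polydisc" for w
    using chart_rigid_lift[OF corner, of w] that U by (metis subsetD)
  from rigid_lift_exists_on_convex[OF open_polydisc convex_polydisc w0 this]
  show thesis using that by metis
qed

end

section \<open>The periods of the two lifts\<close>

text \<open>
  The periods form a group, and the golden ratio \<open>\<phi>\<close> and \<open>1\<close> generate a group that contains all
  powers of \<open>p = \<phi> - 1\<close>, because \<open>p\<^sup>n\<^sup>+\<^sup>2 = p\<^sup>n - p\<^sup>n\<^sup>+\<^sup>1\<close>. As \<open>p < 1\<close>, it is dense.
\<close>

lemma golden_periods_constant:
  fixes H :: "real \<Rightarrow> 'b"
  assumes "Hausdorff_space X" "continuous_map euclideanreal X H"
    and one: "\<And>x. H (x + 1) = H x" and golden: "\<And>x. H (x + golden) = H x"
  shows "H x = H 0"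
proof -
  define p where "p = golden - 1"
  have p: "0 < p" "p < 1" "p\<^sup>2 = 1 - p"
  proof -
    show "0 < p" using golden_gt_1 by (simp add: p_def)
    show sq: "p\<^sup>2 = 1 - p" using golden_square by (simp add: p_def power2_eq_square algebra_simps)
    then show "p < 1" using \<open>0 < p\<close> by (smt (verit) zero_less_power)
  qed
  have diff: "H (x + (u - v)) = H x" if "\<And>x. H (x + u) = H x" "\<And>x. H (x + v) = H x" for u v x
    using that(1)[of "x - v"] that(2)[of "x - v"] by (simp add: algebra_simps)
  have pow: "(\<forall>x. H (x + p ^ n) = H x) \<and> (\<forall>x. H (x + p ^ Suc n) = H x)" for n
  proof (induction n)
    case 0
    have "H (x + p) = H x" for x using diff[OF golden one, of x] by (simp add: p_def)
    then show ?case using one by simp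
  next
    case (Suc n)
    have "p ^ Suc (Suc n) = p ^ n * p\<^sup>2" by (simp add: power2_eq_square)
    then have "p ^ Suc (Suc n) = p ^ n - p ^ Suc n" by (simp add: p(3) algebra_simps)
    then show ?case using Suc diff[of "p ^ n" "p ^ Suc n"] by simp
  qed
  have mult: "H (of_int m * p ^ n) = H 0" for m n
  proof -
    have nat: "\<forall>x. H (x + of_nat N * p ^ n) = H x" for N
    proof (induction N)
      case (Suc N)
      have "H (x + of_nat (Suc N) * p ^ n) = H ((x + of_nat N * p ^ n) + p ^ n)" for x
        by (simp add: algebra_simps)
      then show ?case using pow[of n] Suc by simp
    qed simp
    show ?thesis
    proof (cases "m \<ge> 0")
      case True
      then show ?thesis using nat[of "nat m", rule_format, of 0] by simp
    next
      case False
      then show ?thesis using nat[of "nat (- m)", rule_format, of "of_int m * p ^ n"] by simp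
    qed
  qed
  have "continuous_map euclideanreal X (\<lambda>_. H 0)"
    using continuous_map_image_subset_topspace[OF assms(2)] by auto
  then have closed: "closed {y. H y = H 0}"
    using closedin_continuous_maps_eq[OF assms(1,2)] by simp
  have mem: "of_int \<lfloor>x / p ^ n\<rfloor> * p ^ n \<in> {y. H y = H 0}" for n
    using mult by simp
  have "(\<lambda>n. of_int \<lfloor>x / p ^ n\<rfloor> * p ^ n) \<longlonglongrightarrow> x"
  proof -
    have le: "norm (of_int \<lfloor>x / p ^ n\<rfloor> * p ^ n - x) \<le> p ^ n" for n
    proof -
      have "of_int \<lfloor>x / p ^ n\<rfloor> * p ^ n - x = (of_int \<lfloor>x / p ^ n\<rfloor> - x / p ^ n) * p ^ n"
        using p(1) by (simp add: field_simps)
      moreover have "\<bar>of_int \<lfloor>x / p ^ n\<rfloor> - x / p ^ n\<bar> \<le> 1" by linarith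
      ultimately show ?thesis using p(1) by (simp add: abs_mult mult_le_cancel_right1)
    qed
    have "(\<lambda>n. p ^ n) \<longlonglongrightarrow> 0" using p(1,2) by (intro LIMSEQ_realpow_zero) simp_all
    then have "(\<lambda>n. of_int \<lfloor>x / p ^ n\<rfloor> * p ^ n - x) \<longlonglongrightarrow> 0"
      by (rule Lim_null_comparison[rotated]) (intro always_eventually allI le)
    then show ?thesis by (rule LIM_zero_cancel)
  qed
  from closed_sequentially[OF closed mem this] show ?thesis by simp
qed

text \<open>
  Points of the level set with \<open>\<bar>z\<^sub>1\<bar>\<^sup>2 = \<bar>z\<^sub>2\<bar>\<^sup>2 = \<sigma> / 2\<close>, \<open>\<bar>z\<^sub>3\<bar>\<^sup>2 = \<phi> \<sigma> / 2\<close> and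
  \<open>\<bar>z\<^sub>4\<bar>\<^sup>2 = (\<phi> - 1) \<sigma>\<close>, seen in two charts. In the first one, the real and imaginary parts of \<open>\<zeta>\<close>
  are the angles of \<open>z\<^sub>1\<close> and \<open>z\<^sub>2\<close>, while \<open>z\<^sub>3\<close> and \<open>z\<^sub>4\<close> are positive. The element of \<open>N\<close> that
  makes \<open>z\<^sub>1\<close> and \<open>z\<^sub>2\<close> positive leads to the angles of \<open>z\<^sub>3\<close> and \<open>z\<^sub>4\<close> in the second one. The
  absolute values are such that both points lie in the polydisc.
\<close>

definition torus_12 :: "complex \<Rightarrow> complex \<times> complex" where
  "torus_12 \<zeta> = (cis (2 * pi * Re \<zeta>) * sqrt (kite_sigma / 2), cis (2 * pi * Im \<zeta>) * sqrt (kite_sigma / 2))"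

definition torus_34 :: "complex \<Rightarrow> complex \<times> complex" where
  "torus_34 \<zeta> =
     (cis (2 * pi * (- (golden - 1) * (Re \<zeta> + Im \<zeta>))) * sqrt (golden * kite_sigma / 2),
      cis (2 * pi * ((golden - 1) * Re \<zeta> - Im \<zeta>)) * sqrt ((golden - 1) * kite_sigma))"

interpretation c12: kite_corner 1 2 3 4
    "\<lambda>w. golden * kite_sigma - (cmod (fst w))\<^sup>2 - (golden - 1) * (cmod (snd w))\<^sup>2"
    "\<lambda>w. (golden - 1) * (kite_sigma + (cmod (fst w))\<^sup>2 - (cmod (snd w))\<^sup>2)"
    "golden - 1" "golden - 1" 1 0
  by (rule kite_corner_12)

interpretation c34: kite_corner 3 4 1 2
    "\<lambda>w. (golden - 1) * (kite_sigma - (cmod (fst w))\<^sup>2 + (cmod (snd w))\<^sup>2)"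
    "\<lambda>w. golden * kite_sigma - (golden - 1) * (cmod (fst w))\<^sup>2 - (cmod (snd w))\<^sup>2"
    0 1 "golden - 1" "golden - 1"
  by (rule kite_corner_34)

lemma torus_cmod:
  "(cmod (fst (torus_12 \<zeta>)))\<^sup>2 = kite_sigma / 2" "(cmod (snd (torus_12 \<zeta>)))\<^sup>2 = kite_sigma / 2"
  "(cmod (fst (torus_34 \<zeta>)))\<^sup>2 = golden * kite_sigma / 2"
  "(cmod (snd (torus_34 \<zeta>)))\<^sup>2 = (golden - 1) * kite_sigma"
  using kite_sigma_pos golden_gt_1 by (simp_all add: torus_12_def torus_34_def norm_mult)

lemma torus_off_axes: "torus_12 \<zeta> \<in> off_axes" "torus_34 \<zeta> \<in> off_axes"
  using kite_sigma_pos golden_gt_1 by (simp_all add: torus_12_def torus_34_def off_axes_def)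

lemma continuous_torus: "continuous_on S torus_12" "continuous_on S torus_34"
  unfolding torus_12_def torus_34_def by (intro continuous_intros continuous_on_cis)+

lemma torus_same_class: "kite_class (c12.sec (torus_12 \<zeta>)) = kite_class (c34.sec (torus_34 \<zeta>))"
proof -
  define t where "t = - (golden - 1) * (Re \<zeta> + Im \<zeta>)"
  have g: "golden * t = - (Re \<zeta> + Im \<zeta>)" "t + golden * Im \<zeta> = Im \<zeta> - (golden - 1) * Re \<zeta>"
    unfolding t_def using golden_square by (algebra, simp add: algebra_simps)
  have sq: "golden * kite_sigma - kite_sigma / 2 - (golden - 1) * (kite_sigma / 2) = golden * kite_sigma / 2"
    "(golden - 1) * (kite_sigma + kite_sigma / 2 - kite_sigma / 2) = (golden - 1) * kite_sigma"
    "(golden - 1) * (kite_sigma - golden * kite_sigma / 2 + (golden - 1) * kite_sigma) = kite_sigma / 2"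
    "golden * kite_sigma - (golden - 1) * (golden * kite_sigma / 2) - (golden - 1) * kite_sigma = kite_sigma / 2"
    using golden_square by (simp_all add: field_simps, algebra+)
  define W where "W = wind (- Im \<zeta>) t"
  have W: "W $ 1 = - Re \<zeta>" "W $ 2 = - Im \<zeta>" "W $ 3 = t" "W $ 4 = (golden - 1) * Re \<zeta> - Im \<zeta>"
    using g by (simp_all add: W_def)
  have cancel: "cis (2 * pi * - x) * (cis (2 * pi * x) * y) = y" for x y
    by (simp add: mult.assoc[symmetric] cis_mult)
  have "c34.sec (torus_34 \<zeta>) = torus_act (torus_exp W) (c12.sec (torus_12 \<zeta>))"
    unfolding c34.vec_eq torus_act_nth torus_exp_nth c12.sec_nth c34.sec_nth torus_cmod sq W
    by (simp add: torus_12_def torus_34_def t_def cancel cis_mult mult.assoc[symmetric])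
  then show ?thesis using kite_class_wind by (simp add: W_def)
qed

lemma polydisc_subset: "polydisc \<subseteq> kite_U 1 2 3 4" "polydisc \<subseteq> kite_U 3 4 1 2"
proof -
  have aux: "golden * kite_sigma - (golden - 1) * x - y > 0" "(golden - 1) * (kite_sigma + x - y) > 0"
    if "0 \<le> x" "0 \<le> y" "x < kite_sigma" "y < kite_sigma" for x y
  proof -
    have "(golden - 1) * x \<le> (golden - 1) * kite_sigma" using that golden_gt_1 by (intro mult_left_mono) auto
    then show "golden * kite_sigma - (golden - 1) * x - y > 0" using that by (simp add: algebra_simps)
    show "(golden - 1) * (kite_sigma + x - y) > 0" using that golden_gt_1 by simp
  qed
  show "polydisc \<subseteq> kite_U 1 2 3 4"
  proof
    fix w assume "w \<in> polydisc"
    then show "w \<in> kite_U 1 2 3 4"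
      using aux[of "(cmod (snd w))\<^sup>2" "(cmod (fst w))\<^sup>2"] aux[of "(cmod (fst w))\<^sup>2" "(cmod (snd w))\<^sup>2"]
      by (simp add: c12.U_eq polydisc_iff algebra_simps)
  qed
  show "polydisc \<subseteq> kite_U 3 4 1 2"
  proof
    fix w assume "w \<in> polydisc"
    then show "w \<in> kite_U 3 4 1 2"
      using aux[of "(cmod (snd w))\<^sup>2" "(cmod (fst w))\<^sup>2"] aux[of "(cmod (fst w))\<^sup>2" "(cmod (snd w))\<^sup>2"]
      by (simp add: c34.U_eq polydisc_iff algebra_simps)
  qed
qed

lemma torus_polydisc: "torus_12 \<zeta> \<in> polydisc" "torus_34 \<zeta> \<in> polydisc"
proof -
  have "golden * kite_sigma < 2 * kite_sigma" using golden_less_2 kite_sigma_pos by simp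
  then show "torus_12 \<zeta> \<in> polydisc" "torus_34 \<zeta> \<in> polydisc"
    using kite_sigma_pos by (simp_all add: polydisc_iff torus_cmod algebra_simps)
qed

text \<open>
  The lift over the first polydisc has the real period \<open>1\<close> because \<open>torus_12\<close> does, and the real
  period \<open>\<phi>\<close> because it agrees with the second lift and \<open>torus_34\<close> has this period.
\<close>

lemma kite_not_global_quotient:
  assumes "kite_global_quotient M G \<theta> f"
  shows False
proof -
  interpret kite_global_quotient M G \<theta> f by (rule assms)
  let ?e = "\<lambda>w. f (kite_class (c12.sec w))" and ?e' = "\<lambda>w. f (kite_class (c34.sec w))"
  obtain L0 where L0: "rigid_lift ?e polydisc L0"
    by (rule polydisc_rigid_lift[OF kite_corner_12 polydisc_subset(1)])
  obtain L' where L': "rigid_lift ?e' polydisc L'"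
    by (rule polydisc_rigid_lift[OF kite_corner_34 polydisc_subset(2)])
  have "orbit G \<theta> (L0 (torus_12 0)) = orbit G \<theta> (L' (torus_34 0))"
    using rigid_lift_proj[OF L0 torus_polydisc(1)] rigid_lift_proj[OF L' torus_polydisc(2)]
    by (simp only: torus_same_class)
  from fibre_transitive[OF rigid_lift_topspace[OF L0 torus_polydisc(1)]
      rigid_lift_topspace[OF L' torus_polydisc(2)] this]
  obtain \<delta> where \<delta>: "\<delta> \<in> \<theta> ` carrier G" "\<delta> (L0 (torus_12 0)) = L' (torus_34 0)"
    by blast
  define L where "L = \<delta> \<circ> L0"
  have L: "rigid_lift ?e polydisc L" unfolding L_def by (rule rigid_lift_translate[OF L0 \<delta>(1)])
  have contL: "continuous_map euclidean (mtop M) (L \<circ> torus_12)"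
  proof (rule continuous_map_compose[OF _ rigid_lift_continuous[OF L]])
    show "continuous_map euclidean (top_of_set polydisc) torus_12"
      using continuous_torus(1)[of UNIV] torus_polydisc by (auto simp: continuous_map_in_subtopology)
  qed
  have eq: "L (torus_12 \<zeta>) = L' (torus_34 \<zeta>)" for \<zeta>
  proof -
    have "(L \<circ> torus_12) \<zeta> = L' (torus_34 \<zeta>)"
    proof (rule rigid_lift_continuation[OF L' open_UNIV connected_UNIV UNIV_I])
      show "torus_34 ` UNIV \<subseteq> polydisc \<inter> off_axes" using torus_polydisc torus_off_axes by blast
      show "orbit G \<theta> ((L \<circ> torus_12) x) = ?e' (torus_34 x)" for x
        using rigid_lift_proj[OF L torus_polydisc(1)] torus_same_class by simp
      show "(L \<circ> torus_12) 0 = L' (torus_34 0)" using \<delta>(2) by (simp add: L_def)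
      show "continuous_map (top_of_set UNIV) (mtop M) (L \<circ> torus_12)"
        unfolding subtopology_UNIV by (rule contL)
    qed (simp_all add: continuous_torus)
    then show ?thesis by simp
  qed
  define H where "H = (\<lambda>x. L (torus_12 (complex_of_real x)))"
  have H_const: "H x = H 0" for x
  proof (rule golden_periods_constant[OF Hausdorff])
    have "continuous_map euclideanreal euclidean complex_of_real"
      by (simp add: continuous_on_of_real_id)
    from continuous_map_compose[OF this contL]
    show "continuous_map euclideanreal (mtop M) H" by (simp add: H_def comp_def)
    show "H (x + 1) = H x" for x
      by (simp add: H_def torus_12_def distrib_left flip: cis_mult)
    have "(golden - 1) * (x + golden) = (golden - 1) * x + 1" for x
      using golden_square by algebra
    moreover have "- (golden - 1) * (x + golden) = - (golden - 1) * x - 1" for x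
      using golden_square by algebra
    ultimately have "torus_34 (complex_of_real (x + golden)) = torus_34 (complex_of_real x)" for x
      by (simp add: torus_34_def distrib_left right_diff_distrib flip: cis_mult cis_divide del: of_real_add)
    then show "H (x + golden) = H x" for x by (simp add: H_def eq)
  qed
  have "cis (2 * pi * x) \<in> (\<lambda>u. u $ 1) ` {u \<in> kite_N. u $ 3 = 1 \<and> u $ 4 = 1}" for x
  proof -
    have U: "torus_12 \<zeta> \<in> kite_U 1 2 3 4" for \<zeta> using torus_polydisc polydisc_subset by blast
    have "?e (torus_12 0) = ?e (torus_12 (complex_of_real x))"
      using rigid_lift_proj[OF L torus_polydisc(1), of 0]
        rigid_lift_proj[OF L torus_polydisc(1), of "complex_of_real x"] H_const[of x]
      by (simp add: H_def)
    then have cls: "kite_class (c12.sec (torus_12 0)) = kite_class (c12.sec (torus_12 (complex_of_real x)))"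
      using class_eqI[OF c12.sec_level[OF U] c12.sec_level[OF U]] by blast
    obtain u where u: "u \<in> kite_N" "u $ 3 = 1" "u $ 4 = 1"
      "torus_12 (complex_of_real x) = (u $ 1 * fst (torus_12 0), u $ 2 * snd (torus_12 0))"
      by (rule c12.same_class[OF U U cls])
    then have "cis (2 * pi * x) = u $ 1" using kite_sigma_pos by (simp add: torus_12_def)
    then show ?thesis using u by blast
  qed
  then have "range (\<lambda>x. cis (2 * pi * x)) \<subseteq> (\<lambda>u. u $ 1) ` {u \<in> kite_N. u $ 3 = 1 \<and> u $ 4 = 1}" by blast
  then have "countable (range (\<lambda>x. cis (2 * pi * x)))"
    using c12.countable_Gamma countable_image countable_subset by blast
  moreover have "continuous_on UNIV (\<lambda>x. cis (2 * pi * x))" by (intro continuous_intros continuous_on_cis)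
  ultimately have "cis (2 * pi * 0) = cis (2 * pi * (1 / 2))"
    using continuous_countable_range_const[OF connected_UNIV] by blast
  then show False by simp
qed

theorem theorem6p1:
  fixes Nt :: "('a, 'e::real_normed_vector) mfd"
    and \<Delta> :: "'g monoid"
    and \<theta> :: "'g \<Rightarrow> 'a \<Rightarrow> 'a"
  assumes "is_model (quotient_model Nt \<Delta> \<theta>)"
  shows "\<not> (\<exists>f. quasifold_diffeo kite_quasifold (global_quotient Nt \<Delta> \<theta>) f)"
  using assms kite_not_global_quotient unfolding kite_global_quotient_def by blast

end
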